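(* Let $\Delta$ be an infinite additive subgroup of $\mathbb{C}$, let $b\in\mathbb{C}$ with $2b\notin\Delta$, and let $\varphi:\Delta\to\mathbb{C}^+$ be a group homomorphism. Then for every positive integer $N$, the Lie conformal algebra $CL(b,\varphi)$ cannot be embedded into the general Lie conformal algebra $gc_N$; i.e. there is no injective homomorphism of Lie conformal algebras $CL(b,\varphi)\to gc_N$.
   Context: $\mathbb{C}^+$ is the additive group of $\mathbb{C}$. A Lie conformal algebra $R$ is a $\mathbb{C}[\partial]$-module with a $\mathbb{C}$-bilinear map ($\lambda$-bracket) $R\times R\to R[\lambda]$, $(a,b)\mapsto[a_\lambda b]$, satisfying $[\partial a_\lambda b]=-\lambda[a_\lambda b]$, $[a_\lambda\partial b]=(\lambda+\partial)[a_\lambda b]$, $[a_\lambda b]=-[b_{-\lambda-\partial}a]$ and $[a_\lambda[b_\mu c]]=[[a_\lambda b]_{\lambda+\mu}c]+[b_\mu[a_\lambda c]]$ for all $a,b,c\in R$. A homomorphism of Lie conformal algebras is a $\mathbb{C}[\partial]$-linear map preserving the $\lambda$-bracket. $CL(b,\varphi)=\bigoplus_{\alpha\in\Delta}\mathbb{C}[\partial]x_\alpha$ is the Lie conformal algebra which is free as a $\mathbb{C}[\partial]$-module on $\{x_\alpha\}_{\alpha\in\Delta}$, with $$[{x_\alpha}_\lambda x_\beta]=\big((\alpha+b)\partial+(\alpha+\beta+2b)\lambda\big)x_{\alpha+\beta}+\tfrac1b\big(\varphi(\alpha)\beta-\varphi(\beta)\alpha+b(\varphi(\alpha)-\varphi(\beta))\big)x_{\alpha+\beta}.$$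 The general Lie conformal algebra $gc_N$ is the space of all conformal linear maps $a_\lambda:\mathbb{C}[\partial]^N\to\mathbb{C}[\partial]^N[\lambda]$, i.e. $\mathbb{C}$-linear maps with $a_\lambda(\partial v)=(\partial+\lambda)a_\lambda v$, with $\mathbb{C}[\partial]$-module structure $(\partial a)_\lambda v=-\lambda a_\lambda v$ and $\lambda$-bracket $[a_\lambda b]_\mu v=a_\lambda(b_{\mu-\lambda}v)-b_{\mu-\lambda}(a_\lambda v)$, for $v\in\mathbb{C}[\partial]^N$. *)

theory Defs
  imports
    "HOL-Analysis.Finite_Cartesian_Product"
    "HOL-Computational_Algebra.Polynomial"
    "HOL-Library.Poly_Mapping"
    "HOL-Library.Function_Algebras"
begin

section \<open>Lie conformal algebras\<close>

text \<open>
  The space \<open>R[\<lambda>]\<close> of polynomials with coefficients in an abelian group \<open>R\<close> is the type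
  \<open>'r poly\<close>, used purely additively.  Multiplication by the variable is \<open>pCons 0\<close>, and an additive
  map \<open>T\<close> of \<open>R\<close> acts on coefficients by \<open>map_poly T\<close>.  The space \<open>R[\<lambda>,\<mu>]\<close> is \<open>'r poly poly\<close> with
  \<open>\<lambda>\<close> as the outer and \<open>\<mu>\<close> as the inner variable.  The ring \<open>\<complex>[\<partial>]\<close> is \<open>complex poly\<close>; the element
  \<open>\<partial>\<close> is \<open>[:0, 1:]\<close> and a constant \<open>c\<close> is \<open>[:c:]\<close>.
\<close>

abbreviation lam :: "'m::zero poly \<Rightarrow> 'm poly" where
  "lam \<equiv> pCons 0"

abbreviation mu :: "'m::zero poly poly \<Rightarrow> 'm poly poly" where
  "mu \<equiv> map_poly (pCons 0)"

text \<open>For \<open>P = \<Sum>k. \<lambda>\<^sup>k c\<^sub>k\<close> this is \<open>\<Sum>k. T\<^sup>k (F c\<^sub>k)\<close>: the map \<open>F\<close> is applied to the coefficients and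
  (multiplication by) the variable is replaced by the operator \<open>T\<close>.\<close>

definition psubst :: "('m \<Rightarrow> 'm) \<Rightarrow> ('r \<Rightarrow> 'm) \<Rightarrow> 'r::zero poly \<Rightarrow> 'm::comm_monoid_add" where
  "psubst T F P = (\<Sum>k\<le>degree P. (T ^^ k) (F (coeff P k)))"

definition psubst2 ::
    "('r poly poly \<Rightarrow> 'r poly poly) \<Rightarrow> 'r::comm_monoid_add poly \<Rightarrow> 'r poly poly" where
  "psubst2 T P = psubst T (\<lambda>d. [:[:d:]:]) P"

text \<open>The carrier is a subset of a type of class \<open>ab_group_add\<close>, from which it inherits its
  addition.\<close>

record (overloaded) ('r::ab_group_add) lca =
  lca_carrier :: "'r set"
  lca_scale :: "complex poly \<Rightarrow> 'r \<Rightarrow> 'r"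
  lca_bracket :: "'r \<Rightarrow> 'r \<Rightarrow> 'r poly"

definition lca_del :: "('r::ab_group_add) lca \<Rightarrow> 'r \<Rightarrow> 'r" where
  "lca_del R = lca_scale R [:0, 1:]"

locale lie_conformal_algebra =
  fixes R :: "('r::ab_group_add) lca"
  assumes zero_closed: "0 \<in> lca_carrier R"
    and add_closed: "\<lbrakk>x \<in> lca_carrier R; y \<in> lca_carrier R\<rbrakk> \<Longrightarrow> x + y \<in> lca_carrier R"
    and scale_closed: "x \<in> lca_carrier R \<Longrightarrow> lca_scale R p x \<in> lca_carrier R"
    and scale_add_right: "\<lbrakk>x \<in> lca_carrier R; y \<in> lca_carrier R\<rbrakk> \<Longrightarrow>
        lca_scale R p (x + y) = lca_scale R p x + lca_scale R p y"
    and scale_add_left: "x \<in> lca_carrier R \<Longrightarrow>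
        lca_scale R (p + q) x = lca_scale R p x + lca_scale R q x"
    and scale_scale: "x \<in> lca_carrier R \<Longrightarrow>
        lca_scale R p (lca_scale R q x) = lca_scale R (p * q) x"
    and scale_one: "x \<in> lca_carrier R \<Longrightarrow> lca_scale R 1 x = x"
    and bracket_closed: "\<lbrakk>x \<in> lca_carrier R; y \<in> lca_carrier R\<rbrakk> \<Longrightarrow>
        coeff (lca_bracket R x y) k \<in> lca_carrier R"
    and bracket_add_left:
      "\<lbrakk>x \<in> lca_carrier R; x' \<in> lca_carrier R; y \<in> lca_carrier R\<rbrakk> \<Longrightarrow>
        lca_bracket R (x + x') y = lca_bracket R x y + lca_bracket R x' y"
    and bracket_add_right:
      "\<lbrakk>x \<in> lca_carrier R; y \<in> lca_carrier R; y' \<in> lca_carrier R\<rbrakk> \<Longrightarrow>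
        lca_bracket R x (y + y') = lca_bracket R x y + lca_bracket R x y'"
    and bracket_const_left: "\<lbrakk>x \<in> lca_carrier R; y \<in> lca_carrier R\<rbrakk> \<Longrightarrow>
        lca_bracket R (lca_scale R [:c:] x) y = map_poly (lca_scale R [:c:]) (lca_bracket R x y)"
    and bracket_const_right: "\<lbrakk>x \<in> lca_carrier R; y \<in> lca_carrier R\<rbrakk> \<Longrightarrow>
        lca_bracket R x (lca_scale R [:c:] y) = map_poly (lca_scale R [:c:]) (lca_bracket R x y)"
    and sesqui_left: "\<lbrakk>x \<in> lca_carrier R; y \<in> lca_carrier R\<rbrakk> \<Longrightarrow>
        lca_bracket R (lca_del R x) y = - lam (lca_bracket R x y)"
    and sesqui_right: "\<lbrakk>x \<in> lca_carrier R; y \<in> lca_carrier R\<rbrakk> \<Longrightarrow>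
        lca_bracket R x (lca_del R y)
          = lam (lca_bracket R x y) + map_poly (lca_del R) (lca_bracket R x y)"
    and skew: "\<lbrakk>x \<in> lca_carrier R; y \<in> lca_carrier R\<rbrakk> \<Longrightarrow>
        lca_bracket R x y
          = - psubst (\<lambda>P. - lam P - map_poly (lca_del R) P) (\<lambda>d. [:d:]) (lca_bracket R y x)"
    and jacobi: "\<lbrakk>x \<in> lca_carrier R; y \<in> lca_carrier R; z \<in> lca_carrier R\<rbrakk> \<Longrightarrow>
        psubst mu (\<lambda>d. psubst2 lam (lca_bracket R x d)) (lca_bracket R y z)
          = psubst lam (\<lambda>d. psubst2 (\<lambda>P. lam P + mu P) (lca_bracket R d z)) (lca_bracket R x y)
          + psubst lam (\<lambda>d. psubst2 mu (lca_bracket R y d)) (lca_bracket R x z)"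

definition lca_hom ::
    "('r::ab_group_add) lca \<Rightarrow> ('s::ab_group_add) lca \<Rightarrow> ('r \<Rightarrow> 's) \<Rightarrow> bool" where
  "lca_hom R S f \<longleftrightarrow>
     (\<forall>x\<in>lca_carrier R. f x \<in> lca_carrier S) \<and>
     (\<forall>x\<in>lca_carrier R. \<forall>y\<in>lca_carrier R. f (x + y) = f x + f y) \<and>
     (\<forall>p. \<forall>x\<in>lca_carrier R. f (lca_scale R p x) = lca_scale S p (f x)) \<and>
     (\<forall>x\<in>lca_carrier R. \<forall>y\<in>lca_carrier R.
        map_poly f (lca_bracket R x y) = lca_bracket S (f x) (f y))"

definition lca_embeds :: "('r::ab_group_add) lca \<Rightarrow> ('s::ab_group_add) lca \<Rightarrow> bool" where
  "lca_embeds R S \<longleftrightarrow> (\<exists>f. lca_hom R S f \<and> inj_on f (lca_carrier R))"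


section \<open>The Lie conformal algebra \<open>CL(b,\<phi>)\<close>\<close>

definition additive_subgrp :: "('a::ab_group_add) set \<Rightarrow> bool" where
  "additive_subgrp D \<longleftrightarrow>
     0 \<in> D \<and> (\<forall>x\<in>D. \<forall>y\<in>D. x + y \<in> D) \<and> (\<forall>x\<in>D. - x \<in> D)"

text \<open>Polynomials in \<open>\<lambda>\<close> (outer variable) and \<open>\<partial>\<close> (inner variable).\<close>

abbreviation LamP :: "complex poly poly" where "LamP \<equiv> [:0, 1:]"
abbreviation DelP :: "complex poly poly" where "DelP \<equiv> [:[:0, 1:]:]"
abbreviation ConstP :: "complex \<Rightarrow> complex poly poly" where "ConstP c \<equiv> [:[:c:]:]"

definition CL_coeff ::
    "complex \<Rightarrow> (complex \<Rightarrow> complex) \<Rightarrow> complex \<Rightarrow> complex \<Rightarrow> complex poly poly" where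
  "CL_coeff b \<phi> \<alpha> \<beta> =
     ConstP (\<alpha> + b) * DelP + ConstP (\<alpha> + \<beta> + 2 * b) * LamP
     + ConstP (1 / b * (\<phi> \<alpha> * \<beta> - \<phi> \<beta> * \<alpha> + b * (\<phi> \<alpha> - \<phi> \<beta>)))"

definition subst_del :: "complex poly \<Rightarrow> complex poly poly \<Rightarrow> complex poly poly" where
  "subst_del p q = poly (map_poly ConstP p) q"

text \<open>The bracket is the extension of the bracket of the generators by sesquilinearity:
  \<open>[p(\<partial>)x\<^sub>\<alpha> \<lambda> q(\<partial>)x\<^sub>\<beta>] = p(-\<lambda>) q(\<lambda>+\<partial>) [x\<^sub>\<alpha> \<lambda> x\<^sub>\<beta>]\<close>.\<close>

definition CL_bracket ::
    "complex \<Rightarrow> (complex \<Rightarrow> complex) \<Rightarrow> (complex \<Rightarrow>\<^sub>0 complex poly) \<Rightarrow>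
     (complex \<Rightarrow>\<^sub>0 complex poly) \<Rightarrow> (complex \<Rightarrow>\<^sub>0 complex poly) poly" where
  "CL_bracket b \<phi> f g =
     (\<Sum>\<alpha>\<in>Poly_Mapping.keys f. \<Sum>\<beta>\<in>Poly_Mapping.keys g.
        map_poly (Poly_Mapping.single (\<alpha> + \<beta>))
          (subst_del (Poly_Mapping.lookup f \<alpha>) (- LamP)
           * subst_del (Poly_Mapping.lookup g \<beta>) (LamP + DelP) * CL_coeff b \<phi> \<alpha> \<beta>))"

definition CL_scale ::
    "complex poly \<Rightarrow> (complex \<Rightarrow>\<^sub>0 complex poly) \<Rightarrow> (complex \<Rightarrow>\<^sub>0 complex poly)" where
  "CL_scale p = Poly_Mapping.map (\<lambda>q. p * q)"

definition CL :: "complex set \<Rightarrow> complex \<Rightarrow> (complex \<Rightarrow> complex) \<Rightarrow>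
    (complex \<Rightarrow>\<^sub>0 complex poly) lca" where
  "CL D b \<phi> = \<lparr>
     lca_carrier = {f. Poly_Mapping.keys f \<subseteq> D},
     lca_scale = CL_scale,
     lca_bracket = CL_bracket b \<phi> \<rparr>"


section \<open>The general Lie conformal algebra \<open>gc\<^sub>N\<close>, with \<open>N = CARD('n)\<close>\<close>

type_synonym 'n cvec = "(complex poly) ^ 'n"

type_synonym 'n cmap = "'n cvec \<Rightarrow> 'n cvec poly"

definition conformal_linear :: "('n::finite) cmap \<Rightarrow> bool" where
  "conformal_linear a \<longleftrightarrow>
     (\<forall>v w. a (v + w) = a v + a w) \<and>
     (\<forall>c v. a ([:c:] *s v) = map_poly ((*s) [:c:]) (a v)) \<and>
     (\<forall>v. a ([:0, 1:] *s v) = map_poly ((*s) [:0, 1:]) (a v) + lam (a v))"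

text \<open>The action \<open>(p(\<partial>) a)\<^sub>\<lambda> v = p(-\<lambda>) a\<^sub>\<lambda> v\<close>.\<close>

definition gc_scale :: "complex poly \<Rightarrow> ('n::finite) cmap \<Rightarrow> 'n cmap" where
  "gc_scale p a v = psubst (\<lambda>P. - lam P) (\<lambda>c. map_poly ((*s) [:c:]) (a v)) p"

text \<open>The element \<open>a\<^sub>\<lambda>(b\<^bsub>\<mu>-\<lambda>\<^esub> v) - b\<^bsub>\<mu>-\<lambda>\<^esub>(a\<^sub>\<lambda> v)\<close> of \<open>V[\<lambda>,\<mu>]\<close>.\<close>

definition gc_commutator :: "('n::finite) cmap \<Rightarrow> 'n cmap \<Rightarrow> 'n cvec \<Rightarrow> 'n cvec poly poly" where
  "gc_commutator a b v =
     psubst (\<lambda>P. mu P - lam P) (\<lambda>w. psubst2 lam (a w)) (b v)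
     - psubst lam (\<lambda>w. psubst2 (\<lambda>P. mu P - lam P) (b w)) (a v)"

text \<open>If \<open>[a\<^sub>\<lambda> b] = \<Sum>k. \<lambda>\<^sup>k c\<^sub>k\<close>, then \<open>(c\<^sub>k)\<^sub>\<mu> v\<close> is the coefficient of \<open>\<lambda>\<^sup>k\<close> in the commutator.
  For conformal linear maps only finitely many \<open>c\<^sub>k\<close> are nonzero; see \<open>coeff_gc_bracket\<close>.\<close>

definition gc_bracket :: "('n::finite) cmap \<Rightarrow> 'n cmap \<Rightarrow> 'n cmap poly" where
  "gc_bracket a b = Abs_poly (\<lambda>k v. coeff (gc_commutator a b v) k)"

definition gc :: "(('n::finite) cmap) lca" where
  "gc = \<lparr>
     lca_carrier = {a. conformal_linear a},
     lca_scale = gc_scale,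
     lca_bracket = gc_bracket \<rparr>"


section \<open>Evaluation of polynomials with coefficients in a module\<close>

definition pev :: "(complex poly \<Rightarrow> 'm \<Rightarrow> 'm) \<Rightarrow> complex poly \<Rightarrow> 'm::ab_group_add poly \<Rightarrow> 'm" where
  "pev sc s P = (\<Sum>k\<le>degree P. sc (s ^ k) (coeff P k))"

locale cmodule = module sc for sc :: "complex poly \<Rightarrow> 'm::ab_group_add \<Rightarrow> 'm"
begin

lemma pev_bound:
  assumes "degree P \<le> n"
  shows "pev sc s P = (\<Sum>k\<le>n. sc (s ^ k) (coeff P k))"
  unfolding pev_def using assms
  by (intro sum.mono_neutral_left) (auto simp: coeff_eq_0)

lemma pev_0 [simp]: "pev sc s 0 = 0"
  by (simp add: pev_def)

lemma pev_add: "pev sc s (P + Q) = pev sc s P + pev sc s Q"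
proof -
  let ?n = "max (degree P) (degree Q)"
  have "degree (P + Q) \<le> ?n" by (rule degree_add_le_max)
  then show ?thesis
    by (simp add: pev_bound[of _ ?n] sum.distrib scale_right_distrib)
qed

lemma pev_minus: "pev sc s (- P) = - pev sc s P"
  by (simp add: pev_def sum_negf)

lemma pev_diff: "pev sc s (P - Q) = pev sc s P - pev sc s Q"
  using pev_add[of s P "- Q"] by (simp add: pev_minus)

lemma pev_sum: "pev sc s (sum f A) = (\<Sum>x\<in>A. pev sc s (f x))"
  by (induction A rule: infinite_finite_induct) (simp_all add: pev_add)

lemma pev_pCons [simp]: "pev sc s (pCons a P) = a + sc s (pev sc s P)"
proof -
  have "pev sc s (pCons a P) = (\<Sum>k\<le>Suc (degree P). sc (s ^ k) (coeff (pCons a P) k))"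
    by (rule pev_bound) (simp add: degree_pCons_le)
  also have "\<dots> = a + (\<Sum>k\<le>degree P. sc (s ^ Suc k) (coeff P k))"
    by (subst sum.atMost_Suc_shift) simp
  also have "\<dots> = a + sc s (pev sc s P)"
    by (simp add: pev_def scale_sum_right)
  finally show ?thesis .
qed

lemma pev_map_add:
  assumes "\<And>x y. F (x + y) = F x + F y" and "\<And>k x. F (sc (s ^ k) x) = sc' (t ^ k) (F x)"
    and "cmodule sc'"
  shows "F (pev sc s P) = pev sc' t (map_poly F P)"
proof -
  interpret F: additive F by unfold_locales (rule assms(1))
  interpret M: cmodule sc' by (rule assms(3))
  have F0: "F 0 = 0" by (rule F.zero)
  have d: "degree (map_poly F P) \<le> degree P"
    by (rule degree_le) (simp add: coeff_map_poly F0 coeff_eq_0)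
  show ?thesis
    unfolding M.pev_bound[OF d]
    by (simp add: coeff_map_poly F0 pev_def F.sum assms(2))
qed

lemma pev_map_scale [simp]: "pev sc s (map_poly (sc p) P) = sc p (pev sc s P)"
proof -
  have "cmodule sc" by unfold_locales
  then show ?thesis
    by (subst pev_map_add[of "sc p" s sc s]) (simp_all add: scale_right_distrib mult.commute)
qed

lemma funpow_hom:
  assumes "\<And>x. h (T x) = sc s (h x)"
  shows "h ((T ^^ k) x) = sc (s ^ k) (h x)"
  by (induction k) (simp_all add: assms)

lemma psubst_hom:
  fixes h :: "'b::ab_group_add \<Rightarrow> 'm"
  assumes "\<And>x y. h (x + y) = h x + h y" and "\<And>x. h (T x) = sc s (h x)"
  shows "h (psubst T F P) = (\<Sum>k\<le>degree P. sc (s ^ k) (h (F (coeff P k))))"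
proof -
  interpret h: additive h by unfold_locales (rule assms(1))
  show ?thesis by (simp add: psubst_def h.sum funpow_hom[of h T s, OF assms(2)])
qed

lemma pev_inject:
  assumes "\<And>z. pev sc [:z:] P = pev sc [:z:] Q"
  shows "P = Q"
proof (rule ccontr)
  assume "P \<noteq> Q"
  define D where "D = P - Q"
  from \<open>P \<noteq> Q\<close> obtain k where k: "coeff D k \<noteq> 0"
    unfolding D_def by (metis coeff_diff eq_iff_diff_eq_0 poly_eqI)
  have D: "pev sc [:z:] D = 0" for z by (simp add: D_def pev_diff assms)
  interpret V: vector_space "\<lambda>c. sc [:c:]"
  proof
    fix a b :: complex and x y :: 'm
    have "[:a + b:] = [:a:] + [:b:]" by simp
    then show "sc [:a + b:] x = sc [:a:] x + sc [:b:] x"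
      by (simp only: scale_left_distrib)
    show "sc [:1:] x = x" using scale_one[of x] by (simp add: one_pCons)
  qed (simp_all add: scale_right_distrib mult.commute)
  interpret VP: vector_space_pair "\<lambda>c. sc [:c:]" "(*) :: complex \<Rightarrow> complex \<Rightarrow> complex"
    by unfold_locales (simp_all add: algebra_simps)
  have "V.independent {coeff D k}"
    using k by (simp add: V.independent_insert)
  from VP.linear_independent_extend[OF this, of "\<lambda>_. 1"]
  obtain f where lf: "Vector_Spaces.linear (\<lambda>c. sc [:c:]) (*) f" and f: "f (coeff D k) = 1"
    by auto
  interpret L: Vector_Spaces.linear "\<lambda>c. sc [:c:]" "(*) :: complex \<Rightarrow> complex \<Rightarrow> complex" f
    by (rule lf)
  have f0: "f 0 = 0" by (rule L.zero)
  have d: "degree (map_poly f D) \<le> degree D"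
    by (rule degree_le) (simp add: coeff_map_poly f0 coeff_eq_0)
  have "poly (map_poly f D) z = 0" for z
  proof -
    have "poly (map_poly f D) z = (\<Sum>k\<le>degree D. coeff (map_poly f D) k * z ^ k)"
      unfolding poly_altdef using d
      by (intro sum.mono_neutral_left) (auto simp: coeff_eq_0)
    also have "\<dots> = f (pev sc [:z:] D)"
      by (simp add: pev_def L.sum coeff_map_poly f0 poly_const_pow L.scale mult.commute)
    also have "\<dots> = 0" by (simp add: D f0)
    finally show ?thesis .
  qed
  then have "map_poly f D = 0" by (metis ext poly_0 poly_eq_poly_eq_iff)
  then have "f (coeff D k) = 0"
    by (metis coeff_0 coeff_map_poly f0)
  with f show False by simp
qed

end

text \<open>Polynomials over a module form a module, with scalars acting on coefficients.\<close>

abbreviation pscale :: "(complex poly \<Rightarrow> 'm \<Rightarrow> 'm) \<Rightarrow> complex poly \<Rightarrow> 'm::ab_group_add poly \<Rightarrow> 'm poly" where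
  "pscale sc p \<equiv> map_poly (sc p)"

lemma (in cmodule) cmodule_pscale: "cmodule (pscale sc)"
  by unfold_locales
    (auto intro!: poly_eqI simp: coeff_map_poly scale_right_distrib scale_left_distrib)

text \<open>Evaluation of two-variable polynomials: first the outer variable at \<open>z\<close>, then the inner at \<open>w\<close>.\<close>

definition pev2 ::
    "(complex poly \<Rightarrow> 'm \<Rightarrow> 'm) \<Rightarrow> complex \<Rightarrow> complex \<Rightarrow> 'm::ab_group_add poly poly \<Rightarrow> 'm" where
  "pev2 sc z w P = pev sc [:w:] (pev (pscale sc) [:z:] P)"

context cmodule
begin

interpretation P: cmodule "pscale sc" by (rule cmodule_pscale)

lemma pev2_0 [simp]: "pev2 sc z w 0 = 0"
  by (simp add: pev2_def)

lemma pev2_add: "pev2 sc z w (P + Q) = pev2 sc z w P + pev2 sc z w Q"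
  by (simp add: pev2_def P.pev_add pev_add)

lemma pev2_minus: "pev2 sc z w (- P) = - pev2 sc z w P"
  by (simp add: pev2_def P.pev_minus pev_minus)

lemma pev2_diff: "pev2 sc z w (P - Q) = pev2 sc z w P - pev2 sc z w Q"
  by (simp add: pev2_def P.pev_diff pev_diff)

lemma pev2_lam: "pev2 sc z w (lam P) = sc [:z:] (pev2 sc z w P)"
  by (simp add: pev2_def)

lemma pev2_mu: "pev2 sc z w (mu P) = sc [:w:] (pev2 sc z w P)"
proof -
  have *: "pev (pscale sc) s (mu P) = lam (pev (pscale sc) s P)" for s
    by (subst P.pev_map_add[where F = lam and s = s and sc' = "pscale sc" and t = s])
      (simp_all add: P.cmodule_axioms map_poly_pCons cmodule_pscale)
  show ?thesis by (simp add: pev2_def *)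
qed

lemma pev2_map_scale: "pev2 sc z w (map_poly (map_poly (sc p)) P) = sc p (pev2 sc z w P)"
  by (simp add: pev2_def)

lemma pev2_inject:
  assumes "\<And>z w. pev2 sc z w P = pev2 sc z w Q"
  shows "P = Q"
  using assms unfolding pev2_def by (intro P.pev_inject pev_inject) simp

lemma pev2_psubst:
  assumes "\<And>x. pev2 sc z w (T x) = sc [:u:] (pev2 sc z w x)"
  shows "pev2 sc z w (psubst T F P) = (\<Sum>k\<le>degree P. sc ([:u:] ^ k) (pev2 sc z w (F (coeff P k))))"
  by (rule psubst_hom) (simp_all add: pev2_add assms)

lemma pev2_psubst2:
  assumes "\<And>x. pev2 sc z w (T x) = sc [:u:] (pev2 sc z w x)"
  shows "pev2 sc z w (psubst2 T P) = pev sc [:u:] P"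
  unfolding psubst2_def pev2_psubst[of z w T, OF assms]
  by (simp add: pev2_def pev_def)

end


section \<open>\<open>gc\<^sub>N\<close> is a Lie conformal algebra\<close>

interpretation cvec: cmodule "(*s) :: complex poly \<Rightarrow> 'n::finite cvec \<Rightarrow> 'n cvec"
  by unfold_locales
    (simp_all add: vector_add_ldistrib vector_sadd_rdistrib vector_smult_assoc)

definition val :: "('n::finite) cmap \<Rightarrow> complex \<Rightarrow> 'n cvec \<Rightarrow> 'n cvec" where
  "val a z v = pev (*s) [:z:] (a v)"

lemma cmap_eqI:
  fixes a b :: "('n::finite) cmap"
  assumes "\<And>z v. val a z v = val b z v"
  shows "a = b"
  using assms unfolding val_def by (intro ext cvec.pev_inject) simp

lemma conformal_linear_iff:
  "conformal_linear a \<longleftrightarrow>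
     (\<forall>z v w. val a z (v + w) = val a z v + val a z w) \<and>
     (\<forall>z c v. val a z ([:c:] *s v) = [:c:] *s val a z v) \<and>
     (\<forall>z v. val a z ([:0, 1:] *s v) = [:z, 1:] *s val a z v)"
proof -
  have 1: "(\<forall>v w. a (v + w) = a v + a w) \<longleftrightarrow>
      (\<forall>z v w. val a z (v + w) = val a z v + val a z w)"
    unfolding val_def cvec.pev_add[symmetric] by (metis cvec.pev_inject)
  have 2: "(\<forall>c v. a ([:c:] *s v) = map_poly ((*s) [:c:]) (a v)) \<longleftrightarrow>
      (\<forall>z c v. val a z ([:c:] *s v) = [:c:] *s val a z v)"
    unfolding val_def cvec.pev_map_scale[symmetric] by (metis cvec.pev_inject)
  have *: "[:z, 1:] *s pev (*s) [:z:] P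
      = pev (*s) [:z:] (map_poly ((*s) [:0, 1:]) P + lam P)" for z and P :: "'a cvec poly"
  proof -
    have "[:z, 1:] = [:0, 1:] + [:z:]" by simp
    then show ?thesis
      by (simp only: cvec.pev_add cvec.pev_map_scale cvec.pev_pCons add_0 vector_sadd_rdistrib)
  qed
  have 3: "(\<forall>v. a ([:0, 1:] *s v) = map_poly ((*s) [:0, 1:]) (a v) + lam (a v)) \<longleftrightarrow>
      (\<forall>z v. val a z ([:0, 1:] *s v) = [:z, 1:] *s val a z v)"
    unfolding val_def * by (metis cvec.pev_inject)
  show ?thesis
    unfolding conformal_linear_def 1 2 3 ..
qed

lemma val_add: "conformal_linear a \<Longrightarrow> val a z (v + w) = val a z v + val a z w"
  and val_const: "conformal_linear a \<Longrightarrow> val a z ([:c:] *s v) = [:c:] *s val a z v"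
  and val_del: "conformal_linear a \<Longrightarrow> val a z ([:0, 1:] *s v) = [:z, 1:] *s val a z v"
  by (simp_all add: conformal_linear_iff)

lemma val_sum:
  assumes "conformal_linear a"
  shows "val a z (\<Sum>k\<in>A. f k) = (\<Sum>k\<in>A. val a z (f k))"
proof -
  interpret additive "val a z" by unfold_locales (rule val_add[OF assms])
  show ?thesis by (rule sum)
qed

lemma val_diff:
  assumes "conformal_linear a"
  shows "val a z (v - w) = val a z v - val a z w"
proof -
  interpret additive "val a z" by unfold_locales (rule val_add[OF assms])
  show ?thesis by (rule diff)
qed

lemma const_power: "[:c:] ^ k = [:c ^ k:]" for c :: complex
  by (simp add: poly_const_pow)

lemma val_pev:
  assumes "conformal_linear a"
  shows "(\<Sum>k\<le>degree P. [:u:] ^ k *s val a z (coeff P k)) = val a z (pev (*s) [:u:] P)"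
  by (simp add: pev_def val_sum[OF assms] const_power val_const[OF assms])

definition comm_at :: "('n::finite) cmap \<Rightarrow> 'n cmap \<Rightarrow> complex \<Rightarrow> complex \<Rightarrow> 'n cvec \<Rightarrow> 'n cvec" where
  "comm_at a b z w v = val a z (val b (w - z) v) - val b (w - z) (val a z v)"

lemma pev2_gc_commutator:
  assumes "conformal_linear a" "conformal_linear b"
  shows "pev2 (*s) z w (gc_commutator a b v) = comm_at a b z w v"
proof -
  have 1: "pev2 (*s) z w (mu x - lam x) = [:w - z:] *s pev2 (*s) z w x"
    for x :: "'a cvec poly poly"
  proof -
    have "[:w - z:] = [:w:] - [:z:]" by simp
    then show ?thesis
      by (simp only: cvec.pev2_diff cvec.pev2_mu cvec.pev2_lam vector_sub_rdistrib)
  qed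
  show ?thesis
    unfolding gc_commutator_def comm_at_def cvec.pev2_diff
      cvec.pev2_psubst[OF 1] cvec.pev2_psubst[OF cvec.pev2_lam]
      cvec.pev2_psubst2[OF 1] cvec.pev2_psubst2[OF cvec.pev2_lam]
    unfolding val_def[symmetric] val_pev[OF assms(1)] val_pev[OF assms(2)] ..
qed

context
  fixes a b :: "('n::finite) cmap"
  assumes a: "conformal_linear a" and b: "conformal_linear b"
begin

lemma comm_at_conformal:
  shows "comm_at a b z w (u + v) = comm_at a b z w u + comm_at a b z w v"
    and "comm_at a b z w ([:c:] *s v) = [:c:] *s comm_at a b z w v"
    and "comm_at a b z w ([:0, 1:] *s v) = [:w, 1:] *s comm_at a b z w v"
proof -
  show "comm_at a b z w (u + v) = comm_at a b z w u + comm_at a b z w v"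
    by (simp add: comm_at_def val_add a b)
  show "comm_at a b z w ([:c:] *s v) = [:c:] *s comm_at a b z w v"
    by (simp only: comm_at_def val_const a b vector_ssub_ldistrib)
  have *: "val d z ([:y, 1:] *s v) = [:y + z, 1:] *s val d z v"
    if d: "conformal_linear d" for d z y and v :: "'n cvec"
  proof -
    have "[:y, 1:] *s v = [:y:] *s v + [:0, 1:] *s v"
      by (simp flip: vector_sadd_rdistrib)
    then have "val d z ([:y, 1:] *s v) = [:y:] *s val d z v + [:z, 1:] *s val d z v"
      by (simp only: val_add[OF d] val_const[OF d] val_del[OF d])
    then show ?thesis by (simp flip: vector_sadd_rdistrib)
  qed
  show "comm_at a b z w ([:0, 1:] *s v) = [:w, 1:] *s comm_at a b z w v"
    by (simp add: comm_at_def val_del a b * vector_ssub_ldistrib)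
qed

lemma gc_commutator_conformal:
  shows "gc_commutator a b (u + v) = gc_commutator a b u + gc_commutator a b v"
    and "gc_commutator a b ([:c:] *s v) = map_poly (map_poly ((*s) [:c:])) (gc_commutator a b v)"
    and "gc_commutator a b ([:0, 1:] *s v)
      = map_poly (map_poly ((*s) [:0, 1:])) (gc_commutator a b v) + mu (gc_commutator a b v)"
proof -
  show "gc_commutator a b (u + v) = gc_commutator a b u + gc_commutator a b v"
    by (rule cvec.pev2_inject)
      (simp add: cvec.pev2_add pev2_gc_commutator[OF a b] comm_at_conformal)
  show "gc_commutator a b ([:c:] *s v) = map_poly (map_poly ((*s) [:c:])) (gc_commutator a b v)"
    by (rule cvec.pev2_inject)
      (simp add: cvec.pev2_map_scale pev2_gc_commutator[OF a b] comm_at_conformal)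
  show "gc_commutator a b ([:0, 1:] *s v)
      = map_poly (map_poly ((*s) [:0, 1:])) (gc_commutator a b v) + mu (gc_commutator a b v)"
    by (rule cvec.pev2_inject)
      (simp add: cvec.pev2_map_scale cvec.pev2_mu cvec.pev2_add pev2_gc_commutator[OF a b]
        comm_at_conformal flip: vector_sadd_rdistrib)
qed

lemma gc_commutator_bounded: "\<exists>K. \<forall>v. degree (gc_commutator a b v) \<le> K"
proof -
  define K where "K = Max (range (\<lambda>i. degree (gc_commutator a b (axis i 1))))"
  let ?S = "\<lambda>v. degree (gc_commutator a b v) \<le> K"
  have add: "?S (u + v)" if "?S u" "?S v" for u v
    using that by (simp add: gc_commutator_conformal degree_add_le)
  have map: "degree (map_poly f P) \<le> degree P" if "f 0 = 0"
    for f :: "'n cvec poly \<Rightarrow> 'n cvec poly" and P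
    by (rule degree_le) (simp add: coeff_map_poly that coeff_eq_0)
  have const: "?S ([:c:] *s v)" if "?S v" for c v
    using that map[of "map_poly ((*s) [:c:])" "gc_commutator a b v"]
    by (simp add: gc_commutator_conformal)
  have del: "?S ([:0, 1:] *s v)" if "?S v" for v
    using that map[of "map_poly ((*s) [:0, 1:])" "gc_commutator a b v"]
      map[of "lam" "gc_commutator a b v"]
    by (simp add: gc_commutator_conformal degree_add_le)
  have zero: "?S 0"
    using gc_commutator_conformal(1)[of 0 0] by simp
  have ax: "?S (axis i 1)" for i
    unfolding K_def by (rule Max_ge) auto
  have gen: "?S (p *s axis i 1)" for p i
  proof (induction p)
    case 0
    show ?case using zero by simp
  next
    case (pCons c p)
    have "pCons c p = [:c:] + [:0, 1:] * p" by simp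
    then have "pCons c p *s axis i 1 = [:c:] *s axis i 1 + [:0, 1:] *s (p *s axis i (1 :: complex poly))"
      by (simp only: vector_sadd_rdistrib vector_smult_assoc)
    then show ?case using add[OF const[OF ax] del[OF pCons.IH]] by simp
  qed
  have "?S v" for v
  proof -
    have sum: "?S (\<Sum>i\<in>I. v $ i *s axis i 1)" for I :: "'n set"
      by (induction I rule: infinite_finite_induct) (simp_all add: zero add gen)
    have "(\<Sum>i\<in>UNIV. v $ i *s axis i 1) = v"
      by (simp add: vec_eq_iff axis_def if_distrib[of "(*) _"] cong: if_cong)
    with sum[of UNIV] show ?thesis by simp
  qed
  then show ?thesis by blast
qed

lemma coeff_gc_bracket: "coeff (gc_bracket a b) k v = coeff (gc_commutator a b v) k"
proof -
  obtain K where "\<And>v. degree (gc_commutator a b v) \<le> K"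
    using gc_commutator_bounded by blast
  then have "(\<lambda>v. coeff (gc_commutator a b v) k) = 0" if "k > K" for k
    using that by (intro ext) (metis coeff_eq_0 le_less_trans zero_fun_apply)
  then have "coeff (gc_bracket a b) = (\<lambda>k v. coeff (gc_commutator a b v) k)"
    unfolding gc_bracket_def by (intro coeff_Abs_poly[where n = K])
  then show ?thesis by simp
qed

lemma gc_bracket_closed: "conformal_linear (coeff (gc_bracket a b) k)"
  unfolding conformal_linear_def
  by (simp add: coeff_gc_bracket gc_commutator_conformal coeff_map_poly)

lemma val_gc_bracket:
  "(\<Sum>k\<le>degree (gc_bracket a b). [:u:] ^ k *s val (coeff (gc_bracket a b) k) w v)
     = comm_at a b u w v"
proof -
  interpret P: cmodule "pscale ((*s) :: complex poly \<Rightarrow> 'n cvec \<Rightarrow> 'n cvec)"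
    by (rule cvec.cmodule_pscale)
  have d: "degree (gc_commutator a b v) \<le> degree (gc_bracket a b)"
    by (rule degree_le) (simp add: coeff_eq_0 flip: coeff_gc_bracket)
  have "comm_at a b u w v = pev2 (*s) u w (gc_commutator a b v)"
    by (simp add: pev2_gc_commutator a b)
  also have "\<dots> = (\<Sum>k\<le>degree (gc_bracket a b). [:u:] ^ k *s val (coeff (gc_bracket a b) k) w v)"
    unfolding pev2_def P.pev_bound[OF d] val_def
    by (simp add: cvec.pev_sum coeff_gc_bracket)
  finally show ?thesis ..
qed

end

lemma val_plus: "val (a + b) z v = val a z v + val b z v"
  by (simp add: val_def cvec.pev_add)

lemma val_zero [simp]: "val 0 z v = 0"
  by (simp add: val_def)

lemma val_fsum: "val (\<Sum>k\<in>A. f k) z v = (\<Sum>k\<in>A. val (f k) z v)"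
proof -
  interpret additive "\<lambda>a. val a z v" by unfold_locales (rule val_plus)
  show ?thesis by (rule sum)
qed

lemma val_uminus: "val (- a) z v = - val a z v"
  by (simp add: val_def cvec.pev_minus)

lemma val_gc_scale: "val (gc_scale p a) z v = [:poly p (- z):] *s val a z v"
proof -
  have 1: "pev (*s) [:z:] (- lam P) = [:- z:] *s pev (*s) [:z:] P" for P :: "'a cvec poly"
  proof -
    have "[:- z:] = - [:z:]" by simp
    then show ?thesis
      by (simp only: cvec.pev_minus cvec.pev_pCons add_0 cvec.scale_minus_left)
  qed
  have "val (gc_scale p a) z v = (\<Sum>k\<le>degree p. [:- z:] ^ k *s ([:coeff p k:] *s val a z v))"
    unfolding val_def gc_scale_def
    by (subst cvec.psubst_hom[where s = "[:- z:]", OF cvec.pev_add 1]) simp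
  also have "\<dots> = (\<Sum>k\<le>degree p. [:coeff p k * (- z) ^ k:]) *s val a z v"
    by (simp add: cvec.scale_sum_left const_power mult.commute)
  also have "(\<Sum>k\<le>degree p. [:coeff p k * (- z) ^ k:]) = [:poly p (- z):]"
    by (simp add: poly_altdef sum_to_poly)
  finally show ?thesis .
qed

interpretation gc: cmodule "gc_scale :: complex poly \<Rightarrow> ('n::finite) cmap \<Rightarrow> 'n cmap"
proof
  fix p q :: "complex poly" and a b :: "'n cmap"
  show "gc_scale p (a + b) = gc_scale p a + gc_scale p b"
    by (rule cmap_eqI) (simp add: val_plus val_gc_scale vector_add_ldistrib)
  show "gc_scale (p + q) a = gc_scale p a + gc_scale q a"
    by (rule cmap_eqI) (simp add: val_plus val_gc_scale flip: vector_sadd_rdistrib)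
  show "gc_scale p (gc_scale q a) = gc_scale (p * q) a"
    by (rule cmap_eqI) (simp add: val_gc_scale mult.commute)
  show "gc_scale 1 a = a"
    by (rule cmap_eqI) (simp add: val_gc_scale flip: one_pCons)
qed

lemma gc_scale_closed:
  assumes "conformal_linear a"
  shows "conformal_linear (gc_scale p a)"
  unfolding conformal_linear_iff
  by (simp add: val_gc_scale val_add val_const val_del assms vector_add_ldistrib mult.commute)

lemma val_pev_gc:
  "val (pev gc_scale s P) w v = (\<Sum>k\<le>degree P. [:poly s (- w):] ^ k *s val (coeff P k) w v)"
  by (simp add: pev_def val_fsum val_gc_scale const_power)

lemma val_pev_gc_bracket:
  assumes "conformal_linear a" "conformal_linear b"
  shows "val (pev gc_scale s (gc_bracket a b)) w v = comm_at a b (poly s (- w)) w v"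
  by (simp add: val_pev_gc val_gc_bracket assms)

lemma gc_poly_eqI:
  fixes P Q :: "('n::finite) cmap poly"
  assumes "\<And>z w v. val (pev gc_scale [:z:] P) w v = val (pev gc_scale [:z:] Q) w v"
  shows "P = Q"
  by (intro gc.pev_inject cmap_eqI assms)

lemma lie_conformal_algebra_gc: "lie_conformal_algebra (gc :: (('n::finite) cmap) lca)"
proof
  fix x x' y y' z :: "'n cmap" and p q :: "complex poly" and c :: complex and k :: nat
  let ?C = "lca_carrier (gc :: 'n cmap lca)"
  have C [simp]: "u \<in> ?C \<longleftrightarrow> conformal_linear u" for u
    by (simp add: gc_def)
  have sc [simp]: "lca_scale gc = (gc_scale :: _ \<Rightarrow> 'n cmap \<Rightarrow> _)"
    and br [simp]: "lca_bracket gc = (gc_bracket :: 'n cmap \<Rightarrow> _)"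
    and del [simp]: "lca_del gc = (gc_scale [:0, 1:] :: 'n cmap \<Rightarrow> _)"
    by (simp_all add: gc_def lca_del_def)
  have add: "conformal_linear (u + u')" if "conformal_linear u" "conformal_linear u'"
    for u u' :: "'n cmap"
    using that unfolding conformal_linear_iff
    by (simp add: val_plus vector_add_ldistrib)
  show "0 \<in> ?C" by (simp add: conformal_linear_iff)
  show "x + y \<in> ?C" if "x \<in> ?C" "y \<in> ?C" using that add by simp
  show "lca_scale gc p x \<in> ?C" if "x \<in> ?C" using that by (simp add: gc_scale_closed)
  show "lca_scale gc p (x + y) = lca_scale gc p x + lca_scale gc p y"
    by (simp add: gc.scale_right_distrib)
  show "lca_scale gc (p + q) x = lca_scale gc p x + lca_scale gc q x"
    by (simp add: gc.scale_left_distrib)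
  show "lca_scale gc p (lca_scale gc q x) = lca_scale gc (p * q) x" by simp
  show "lca_scale gc 1 x = x" by simp
  show "coeff (lca_bracket gc x y) k \<in> ?C" if "x \<in> ?C" "y \<in> ?C"
    using that by (simp add: gc_bracket_closed)
  show "lca_bracket gc (x + x') y = lca_bracket gc x y + lca_bracket gc x' y"
    if "x \<in> ?C" "x' \<in> ?C" "y \<in> ?C"
    unfolding br by (rule gc_poly_eqI)
      (use that in \<open>simp add: add val_pev_gc_bracket gc.pev_add val_plus comm_at_def val_add\<close>)
  show "lca_bracket gc x (y + y') = lca_bracket gc x y + lca_bracket gc x y'"
    if "x \<in> ?C" "y \<in> ?C" "y' \<in> ?C"
    unfolding br by (rule gc_poly_eqI)
      (use that in \<open>simp add: add val_pev_gc_bracket gc.pev_add val_plus comm_at_def val_add\<close>)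
  show "lca_bracket gc (lca_scale gc [:c:] x) y = map_poly (lca_scale gc [:c:]) (lca_bracket gc x y)"
    if "x \<in> ?C" "y \<in> ?C"
    unfolding br sc by (rule gc_poly_eqI)
      (use that in \<open>simp add: gc_scale_closed val_pev_gc_bracket val_gc_scale comm_at_def val_const
        vector_ssub_ldistrib\<close>)
  show "lca_bracket gc x (lca_scale gc [:c:] y) = map_poly (lca_scale gc [:c:]) (lca_bracket gc x y)"
    if "x \<in> ?C" "y \<in> ?C"
    unfolding br sc by (rule gc_poly_eqI)
      (use that in \<open>simp add: gc_scale_closed val_pev_gc_bracket val_gc_scale comm_at_def val_const
        vector_ssub_ldistrib\<close>)
  show "lca_bracket gc (lca_del gc x) y = - lam (lca_bracket gc x y)"
    if "x \<in> ?C" "y \<in> ?C"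
    unfolding br del
  proof (rule gc_poly_eqI)
    fix r w :: complex and v
    have neg: "[:- r:] *s t = - ([:r:] *s t)" for t :: "'n cvec"
      by (simp add: vec_eq_iff)
    have "val y (w - r) (- ([:r:] *s u)) = - ([:r:] *s val y (w - r) u)" for u
      using that val_const[of y "w - r" "- r" u] by (simp add: neg)
    then show "val (pev gc_scale [:r:] (gc_bracket (gc_scale [:0, 1:] x) y)) w v =
        val (pev gc_scale [:r:] (- lam (gc_bracket x y))) w v"
      using that
      by (simp add: gc_scale_closed val_pev_gc_bracket val_gc_scale gc.pev_minus val_uminus
          comm_at_def val_const vector_ssub_ldistrib neg)
  qed
  show "lca_bracket gc x (lca_del gc y) = lam (lca_bracket gc x y)
      + map_poly (lca_del gc) (lca_bracket gc x y)"
    if "x \<in> ?C" "y \<in> ?C"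
    unfolding br del
    by (rule gc_poly_eqI)
     (use that in \<open>simp add: gc_scale_closed val_pev_gc_bracket val_gc_scale gc.pev_add val_plus
          comm_at_def val_const flip: vector_sadd_rdistrib vector_ssub_ldistrib\<close>)
  show "lca_bracket gc x y
      = - psubst (\<lambda>P. - lam P - map_poly (lca_del gc) P) (\<lambda>d. [:d:]) (lca_bracket gc y x)"
    if xy: "x \<in> ?C" "y \<in> ?C"
    unfolding br del
  proof (rule gc_poly_eqI)
    fix r w :: complex and v
    have 1: "pev gc_scale [:r:] (- lam P - map_poly (gc_scale [:0, 1:]) P)
        = gc_scale [:- r, - 1:] (pev gc_scale [:r:] P)" for P :: "'n cmap poly"
    proof -
      have "[:- r, - 1:] = - [:r:] - [:0, 1 :: complex:]" by simp
      then show ?thesis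
        by (simp only: gc.pev_diff gc.pev_minus gc.pev_pCons gc.pev_map_scale add_0
            gc.scale_left_diff_distrib gc.scale_minus_left)
    qed
    have "pev gc_scale [:r:] (psubst (\<lambda>P. - lam P - map_poly (gc_scale [:0, 1:]) P) (\<lambda>d. [:d:])
        (gc_bracket y x)) = pev gc_scale [:- r, - 1:] (gc_bracket y x)"
      unfolding gc.psubst_hom[where h = "pev gc_scale [:r:]", OF gc.pev_add 1]
      by (simp add: pev_def[of _ "[:- r, - 1:]"])
    then show "val (pev gc_scale [:r:] (gc_bracket x y)) w v =
        val (pev gc_scale [:r:] (- psubst (\<lambda>P. - lam P - map_poly (gc_scale [:0, 1:]) P)
          (\<lambda>d. [:d:]) (gc_bracket y x))) w v"
      using xy by (simp add: gc.pev_minus val_uminus val_pev_gc_bracket comm_at_def)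
  qed
  show "psubst mu (\<lambda>d. psubst2 lam (lca_bracket gc x d)) (lca_bracket gc y z)
      = psubst lam (\<lambda>d. psubst2 (\<lambda>P. lam P + mu P) (lca_bracket gc d z)) (lca_bracket gc x y)
      + psubst lam (\<lambda>d. psubst2 mu (lca_bracket gc y d)) (lca_bracket gc x z)"
    if "x \<in> ?C" "y \<in> ?C" "z \<in> ?C"
    unfolding br
  proof (intro gc.pev2_inject cmap_eqI)
    fix r s w :: complex and v
    have x: "conformal_linear x" and y: "conformal_linear y" and z: "conformal_linear z"
      using that by simp_all
    have 1: "pev2 gc_scale r s (lam P + mu P) = gc_scale [:r + s:] (pev2 gc_scale r s P)"
      for P :: "'n cmap poly poly"
    proof -
      have "[:r + s:] = [:r:] + [:s:]" by simp
      then show ?thesis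
        by (simp only: gc.pev2_add gc.pev2_lam gc.pev2_mu gc.scale_left_distrib)
    qed
    have left: "(\<Sum>k\<le>degree (gc_bracket b c). [:u:] ^ k *s
          comm_at a (coeff (gc_bracket b c) k) t w v)
        = val a t (comm_at b c u (w - t) v) - comm_at b c u (w - t) (val a t v)"
      if a: "conformal_linear a" and bc: "conformal_linear b" "conformal_linear c"
      for a b c :: "'n cmap" and t u
      unfolding val_gc_bracket[OF bc, symmetric] comm_at_def[of a]
      by (simp add: val_sum[OF a] const_power val_const[OF a] vector_ssub_ldistrib sum_subtractf)
    have right: "(\<Sum>k\<le>degree (gc_bracket a b). [:u:] ^ k *s
          comm_at (coeff (gc_bracket a b) k) c t w v)
        = comm_at a b u t (val c (w - t) v) - val c (w - t) (comm_at a b u t v)"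
      if ab: "conformal_linear a" "conformal_linear b" and c: "conformal_linear c"
      for a b c :: "'n cmap" and t u
      unfolding val_gc_bracket[OF ab, symmetric] comm_at_def[of _ c]
      by (simp add: val_sum[OF c] const_power val_const[OF c] vector_ssub_ldistrib sum_subtractf)
    have L: "val (pev2 gc_scale r s (psubst mu (\<lambda>d. psubst2 lam (gc_bracket x d)) (gc_bracket y z))) w v
        = val x r (comm_at y z s (w - r) v) - comm_at y z s (w - r) (val x r v)"
      unfolding gc.pev2_psubst[OF gc.pev2_mu] gc.pev2_psubst2[OF gc.pev2_lam]
      by (simp add: val_fsum val_gc_scale const_power val_pev_gc_bracket gc_bracket_closed x y z
          flip: left[OF x y z])
    have R2: "val (pev2 gc_scale r s (psubst lam (\<lambda>d. psubst2 mu (gc_bracket y d))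
        (gc_bracket x z))) w v
        = val y s (comm_at x z r (w - s) v) - comm_at x z r (w - s) (val y s v)"
      unfolding gc.pev2_psubst[OF gc.pev2_lam] gc.pev2_psubst2[OF gc.pev2_mu]
      by (simp add: val_fsum val_gc_scale const_power val_pev_gc_bracket gc_bracket_closed x y z
          flip: left[OF y x z])
    have R1: "val (pev2 gc_scale r s (psubst lam (\<lambda>d. psubst2 (\<lambda>P. lam P + mu P)
        (gc_bracket d z)) (gc_bracket x y))) w v
        = comm_at x y r (r + s) (val z (w - (r + s)) v) - val z (w - (r + s)) (comm_at x y r (r + s) v)"
      unfolding gc.pev2_psubst[OF gc.pev2_lam] gc.pev2_psubst2[OF 1]
      by (simp add: val_fsum val_gc_scale const_power val_pev_gc_bracket gc_bracket_closed x y z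
          flip: right[OF x y z])
    show "val (pev2 gc_scale r s (psubst mu (\<lambda>d. psubst2 lam (gc_bracket x d))
          (gc_bracket y z))) w v
        = val (pev2 gc_scale r s (psubst lam (\<lambda>d. psubst2 (\<lambda>P. lam P + mu P) (gc_bracket d z))
            (gc_bracket x y)
          + psubst lam (\<lambda>d. psubst2 mu (gc_bracket y d)) (gc_bracket x z))) w v"
      unfolding gc.pev2_add val_plus L R1 R2
      by (simp add: comm_at_def val_diff x y z algebra_simps)
  qed
qed


section \<open>\<open>CL(b,\<phi>)\<close> is a Lie conformal algebra\<close>

lemma lookup_CL_scale [simp]:
  "Poly_Mapping.lookup (CL_scale p u) \<gamma> = p * Poly_Mapping.lookup u \<gamma>"
  by (simp add: CL_scale_def Poly_Mapping.map.rep_eq when_def)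

interpretation cl: cmodule CL_scale
  by unfold_locales
    (auto intro!: poly_mapping_eqI simp: Poly_Mapping.lookup_add algebra_simps)

definition cl_val :: "complex \<Rightarrow> (complex \<Rightarrow> complex) \<Rightarrow> (complex \<Rightarrow>\<^sub>0 complex poly) \<Rightarrow> complex" where
  "cl_val d \<xi> u = (\<Sum>\<gamma>\<in>Poly_Mapping.keys u. poly (Poly_Mapping.lookup u \<gamma>) d * \<xi> \<gamma>)"

lemma cl_val_superset:
  assumes "finite S" "Poly_Mapping.keys u \<subseteq> S"
  shows "cl_val d \<xi> u = (\<Sum>\<gamma>\<in>S. poly (Poly_Mapping.lookup u \<gamma>) d * \<xi> \<gamma>)"
  unfolding cl_val_def using assms
  by (intro sum.mono_neutral_left) (auto simp: in_keys_iff)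

lemma cl_val_add: "cl_val d \<xi> (u + v) = cl_val d \<xi> u + cl_val d \<xi> v"
proof -
  let ?S = "Poly_Mapping.keys u \<union> Poly_Mapping.keys v"
  have "Poly_Mapping.keys (u + v) \<subseteq> ?S" by (rule Poly_Mapping.keys_add)
  then show ?thesis
    by (simp add: cl_val_superset[where S = ?S] Poly_Mapping.lookup_add sum.distrib distrib_right)
qed

lemma cl_val_sum: "cl_val d \<xi> (\<Sum>k\<in>A. f k) = (\<Sum>k\<in>A. cl_val d \<xi> (f k))"
proof -
  interpret additive "cl_val d \<xi>" by unfold_locales (rule cl_val_add)
  show ?thesis by (rule sum)
qed

lemma cl_val_minus: "cl_val d \<xi> (- u) = - cl_val d \<xi> u"
proof -
  interpret additive "cl_val d \<xi>" by unfold_locales (rule cl_val_add)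
  show ?thesis by (rule minus)
qed

lemma keys_CL_scale: "Poly_Mapping.keys (CL_scale p u) \<subseteq> Poly_Mapping.keys u"
  by (auto simp: in_keys_iff)

lemma cl_val_scale: "cl_val d \<xi> (CL_scale p u) = poly p d * cl_val d \<xi> u"
  unfolding cl_val_superset[OF finite_keys keys_CL_scale]
  by (simp add: cl_val_def sum_distrib_left mult.assoc)

lemma cl_val_single: "cl_val d \<xi> (Poly_Mapping.single \<gamma> p) = poly p d * \<xi> \<gamma>"
  by (simp add: cl_val_superset[where S = "{\<gamma>}"])

lemma cl_val_fun_sum:
  "(\<Sum>k\<in>A. c k * cl_val d (\<xi> k) u) = cl_val d (\<lambda>\<gamma>. \<Sum>k\<in>A. c k * \<xi> k \<gamma>) u"
  unfolding cl_val_def sum_distrib_left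
  by (subst sum.swap) (simp add: mult.left_commute)

lemma cl_val_fun_add: "cl_val d (\<lambda>\<gamma>. \<xi> \<gamma> + \<psi> \<gamma>) u = cl_val d \<xi> u + cl_val d \<psi> u"
  by (simp add: cl_val_def sum.distrib distrib_left)

lemma cl_val_fun_mult: "cl_val d (\<lambda>\<gamma>. c * \<xi> \<gamma>) u = c * cl_val d \<xi> u"
  by (simp add: cl_val_def sum_distrib_left mult.left_commute)

lemma cl_val_fun_minus: "cl_val d (\<lambda>\<gamma>. - \<xi> \<gamma>) u = - cl_val d \<xi> u"
  by (simp add: cl_val_def sum_negf)

lemma cl_val_swap:
  "cl_val d (\<lambda>\<alpha>. cl_val e (\<lambda>\<beta>. X \<alpha> \<beta>) v) u = cl_val e (\<lambda>\<beta>. cl_val d (\<lambda>\<alpha>. X \<alpha> \<beta>) u) v"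
  unfolding cl_val_def sum_distrib_left
  by (subst sum.swap) (simp add: mult.left_commute)

lemma cl_val_cong:
  "(\<And>\<gamma>. \<gamma> \<in> Poly_Mapping.keys u \<Longrightarrow> \<xi> \<gamma> = \<psi> \<gamma>) \<Longrightarrow> cl_val d \<xi> u = cl_val d \<psi> u"
  by (simp add: cl_val_def)

lemma cl_eqI:
  assumes "\<And>d \<xi>. cl_val d \<xi> u = cl_val d \<xi> v"
  shows "u = v"
proof (rule poly_mapping_eqI)
  fix \<gamma>
  have *: "cl_val d (\<lambda>\<delta>. if \<delta> = \<gamma> then 1 else 0) u = poly (Poly_Mapping.lookup u \<gamma>) d" for d u
    by (simp add: cl_val_superset[where S = "insert \<gamma> (Poly_Mapping.keys u)"] subset_insertI
        if_distrib[of "(*) _"] cong: if_cong)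
  have "poly (Poly_Mapping.lookup u \<gamma>) = poly (Poly_Mapping.lookup v \<gamma>)"
    unfolding *[symmetric] assms ..
  then show "Poly_Mapping.lookup u \<gamma> = Poly_Mapping.lookup v \<gamma>"
    by (simp add: poly_eq_poly_eq_iff)
qed

lemma cl_poly_eqI:
  assumes "\<And>z d \<xi>. cl_val d \<xi> (pev CL_scale [:z:] P) = cl_val d \<xi> (pev CL_scale [:z:] Q)"
  shows "P = Q"
  by (intro cl.pev_inject cl_eqI assms)

definition CL_num :: "complex \<Rightarrow> (complex \<Rightarrow> complex) \<Rightarrow> complex \<Rightarrow> complex \<Rightarrow> complex \<Rightarrow> complex \<Rightarrow> complex" where
  "CL_num b \<phi> \<alpha> \<beta> z d =
     (\<alpha> + b) * d + (\<alpha> + \<beta> + 2 * b) * z + 1 / b * (\<phi> \<alpha> * \<beta> - \<phi> \<beta> * \<alpha> + b * (\<phi> \<alpha> - \<phi> \<beta>))"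

lemma poly_subst_del: "poly (poly (subst_del p q) s) d = poly p (poly (poly q s) d)"
proof -
  have "map_poly ConstP (pCons c p) = pCons (ConstP c) (map_poly ConstP p)" for c p
    by (rule map_poly_pCons) simp
  then show ?thesis
    unfolding subst_del_def by (induction p) simp_all
qed

lemma pev_single:
  "pev CL_scale s (map_poly (Poly_Mapping.single \<gamma>) A) = Poly_Mapping.single \<gamma> (poly A s)"
  by (induction A)
    (simp_all add: map_poly_pCons Poly_Mapping.single_add poly_mapping_eqI
      Poly_Mapping.lookup_add Poly_Mapping.lookup_single when_def)

lemma cl_val_bracket:
  fixes s d
  defines "z \<equiv> poly s d"
  shows "cl_val d \<xi> (pev CL_scale s (CL_bracket b \<phi> f g)) =
    cl_val (- z) (\<lambda>\<alpha>. cl_val (z + d) (\<lambda>\<beta>. CL_num b \<phi> \<alpha> \<beta> z d * \<xi> (\<alpha> + \<beta>)) g) f"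
proof -
  have "cl_val d \<xi> (pev CL_scale s (CL_bracket b \<phi> f g)) =
    (\<Sum>\<alpha>\<in>Poly_Mapping.keys f. \<Sum>\<beta>\<in>Poly_Mapping.keys g.
       poly (Poly_Mapping.lookup f \<alpha>) (- z) * poly (Poly_Mapping.lookup g \<beta>) (z + d)
       * CL_num b \<phi> \<alpha> \<beta> z d * \<xi> (\<alpha> + \<beta>))"
    unfolding CL_bracket_def
    by (simp add: cl.pev_sum cl_val_sum pev_single cl_val_single poly_subst_del CL_coeff_def
        CL_num_def z_def algebra_simps)
  also have "\<dots> = cl_val (- z) (\<lambda>\<alpha>. cl_val (z + d) (\<lambda>\<beta>. CL_num b \<phi> \<alpha> \<beta> z d * \<xi> (\<alpha> + \<beta>)) g) f"
    by (simp add: cl_val_def sum_distrib_left mult.assoc)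
  finally show ?thesis .
qed

lemma cl_val_bracket_sum:
  "(\<Sum>k\<le>degree (CL_bracket b \<phi> f g). u ^ k * cl_val d \<xi> (coeff (CL_bracket b \<phi> f g) k)) =
    cl_val (- u) (\<lambda>\<alpha>. cl_val (u + d) (\<lambda>\<beta>. CL_num b \<phi> \<alpha> \<beta> u d * \<xi> (\<alpha> + \<beta>)) g) f"
proof -
  have "cl_val d \<xi> (pev CL_scale [:u:] (CL_bracket b \<phi> f g)) =
      (\<Sum>k\<le>degree (CL_bracket b \<phi> f g). u ^ k * cl_val d \<xi> (coeff (CL_bracket b \<phi> f g) k))"
    by (simp add: pev_def cl_val_sum cl_val_scale)
  then show ?thesis by (simp add: cl_val_bracket)
qed

lemma CL_num_skew: "CL_num b \<phi> \<beta> \<alpha> (- z - d) d = - CL_num b \<phi> \<alpha> \<beta> z d"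
  by (simp add: CL_num_def divide_inverse algebra_simps)

lemma CL_num_jacobi:
  assumes "b \<noteq> 0"
    and "\<phi> (\<alpha> + \<beta>) = \<phi> \<alpha> + \<phi> \<beta>" "\<phi> (\<alpha> + \<gamma>) = \<phi> \<alpha> + \<phi> \<gamma>" "\<phi> (\<beta> + \<gamma>) = \<phi> \<beta> + \<phi> \<gamma>"
  shows "CL_num b \<phi> \<beta> \<gamma> w (z + d) * CL_num b \<phi> \<alpha> (\<beta> + \<gamma>) z d =
      CL_num b \<phi> \<alpha> \<beta> z (- (z + w)) * CL_num b \<phi> (\<alpha> + \<beta>) \<gamma> (z + w) d
    + CL_num b \<phi> \<alpha> \<gamma> z (w + d) * CL_num b \<phi> \<beta> (\<alpha> + \<gamma>) w d"
proof -
  have num: "CL_num b \<phi> x y z d = (x + b) * d + (x + y + 2 * b) * z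
      + (\<phi> x / b * y - \<phi> y / b * x + b * (\<phi> x / b - \<phi> y / b))" for x y z d
    using assms(1) by (simp add: CL_num_def field_simps)
  show ?thesis
    unfolding num assms(2-) add_divide_distrib by algebra
qed

lemma lie_conformal_algebra_CL:
  assumes D: "additive_subgrp D" and b: "b \<noteq> 0"
    and \<phi>: "\<forall>\<alpha>\<in>D. \<forall>\<beta>\<in>D. \<phi> (\<alpha> + \<beta>) = \<phi> \<alpha> + \<phi> \<beta>"
  shows "lie_conformal_algebra (CL D b \<phi>)"
proof
  fix x x' y y' z :: "complex \<Rightarrow>\<^sub>0 complex poly" and p q :: "complex poly"
    and c :: complex and k :: nat
  let ?R = "CL D b \<phi>"
  let ?C = "lca_carrier ?R"
  have C: "u \<in> ?C \<longleftrightarrow> Poly_Mapping.keys u \<subseteq> D" for u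
    by (simp add: CL_def)
  have sc [simp]: "lca_scale ?R = CL_scale"
    and br [simp]: "lca_bracket ?R = CL_bracket b \<phi>"
    and del [simp]: "lca_del ?R = CL_scale [:0, 1:]"
    by (simp_all add: CL_def lca_del_def)
  show zero: "0 \<in> ?C" by (simp add: C)
  show add: "x + y \<in> ?C" if "x \<in> ?C" "y \<in> ?C" for x y
    using that Poly_Mapping.keys_add[of x y] by (auto simp: C)
  show "lca_scale ?R p x \<in> ?C" if "x \<in> ?C"
    using that keys_CL_scale[of p x] by (auto simp: C)
  show "lca_scale ?R p (x + y) = lca_scale ?R p x + lca_scale ?R p y"
    by (simp add: cl.scale_right_distrib)
  show "lca_scale ?R (p + q) x = lca_scale ?R p x + lca_scale ?R q x"
    unfolding sc by (rule cl.scale_left_distrib)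
  show "lca_scale ?R p (lca_scale ?R q x) = lca_scale ?R (p * q) x"
    unfolding sc by (rule cl.scale_scale)
  show "lca_scale ?R 1 x = x"
    unfolding sc by (rule cl.scale_one)
  show "coeff (lca_bracket ?R x y) k \<in> ?C" if "x \<in> ?C" "y \<in> ?C"
  proof -
    have sum: "sum F A \<in> ?C" if "\<And>i. i \<in> A \<Longrightarrow> F i \<in> ?C" for F and A :: "complex set"
      using that by (induction A rule: infinite_finite_induct) (auto intro: zero add)
    have "Poly_Mapping.single (\<alpha> + \<beta>) r \<in> ?C"
      if "\<alpha> \<in> Poly_Mapping.keys x" "\<beta> \<in> Poly_Mapping.keys y" for \<alpha> \<beta> r
      using that \<open>x \<in> ?C\<close> \<open>y \<in> ?C\<close> D unfolding C additive_subgrp_def by auto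
    then show ?thesis
      unfolding br CL_bracket_def coeff_sum by (intro sum) (simp add: coeff_map_poly)
  qed
  show "lca_bracket ?R (x + x') y = lca_bracket ?R x y + lca_bracket ?R x' y"
    unfolding br by (rule cl_poly_eqI) (simp add: cl_val_bracket cl.pev_add cl_val_add)
  show "lca_bracket ?R x (y + y') = lca_bracket ?R x y + lca_bracket ?R x y'"
    unfolding br
    by (rule cl_poly_eqI) (simp add: cl_val_bracket cl.pev_add cl_val_add cl_val_fun_add)
  show "lca_bracket ?R (lca_scale ?R [:c:] x) y = map_poly (lca_scale ?R [:c:]) (lca_bracket ?R x y)"
    unfolding br sc
    by (rule cl_poly_eqI) (subst cl.pev_map_scale, simp add: cl_val_bracket cl_val_scale)
  show "lca_bracket ?R x (lca_scale ?R [:c:] y) = map_poly (lca_scale ?R [:c:]) (lca_bracket ?R x y)"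
    unfolding br sc
    by (rule cl_poly_eqI)
      (subst cl.pev_map_scale, simp add: cl_val_bracket cl_val_scale cl_val_fun_mult)
  show "lca_bracket ?R (lca_del ?R x) y = - lam (lca_bracket ?R x y)"
    unfolding br del
    by (rule cl_poly_eqI)
      (simp add: cl.pev_minus cl_val_minus cl_val_bracket cl_val_scale del: minus_pCons)
  show "lca_bracket ?R x (lca_del ?R y) = lam (lca_bracket ?R x y)
      + map_poly (lca_del ?R) (lca_bracket ?R x y)"
    unfolding br del
    by (rule cl_poly_eqI, unfold cl.pev_add cl.pev_map_scale)
      (simp add: cl_val_add cl_val_bracket cl_val_scale cl_val_fun_mult cl_val_fun_add
        distrib_right)
  show "lca_bracket ?R x y
      = - psubst (\<lambda>P. - lam P - map_poly (lca_del ?R) P) (\<lambda>d. [:d:]) (lca_bracket ?R y x)"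
    unfolding br del
  proof (rule cl_poly_eqI)
    fix r d \<xi>
    have 1: "pev CL_scale [:r:] (- lam P - map_poly (CL_scale [:0, 1:]) P)
        = CL_scale [:- r, - 1:] (pev CL_scale [:r:] P)" for P
    proof -
      have "[:- r, - 1:] = - [:r:] - [:0, 1 :: complex:]" by simp
      then show ?thesis
        by (simp only: cl.pev_diff cl.pev_minus cl.pev_pCons cl.pev_map_scale add_0
            cl.scale_left_diff_distrib cl.scale_minus_left)
    qed
    have "pev CL_scale [:r:] (psubst (\<lambda>P. - lam P - map_poly (CL_scale [:0, 1:]) P) (\<lambda>d. [:d:])
        (CL_bracket b \<phi> y x)) = pev CL_scale [:- r, - 1:] (CL_bracket b \<phi> y x)"
      unfolding cl.psubst_hom[where h = "pev CL_scale [:r:]", OF cl.pev_add 1]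
      by (simp add: pev_def[of _ "[:- r, - 1:]"])
    moreover have "cl_val d \<xi> (pev CL_scale [:- r, - 1:] (CL_bracket b \<phi> y x))
        = - cl_val d \<xi> (pev CL_scale [:r:] (CL_bracket b \<phi> x y))"
    proof -
      have "cl_val d \<xi> (pev CL_scale [:- r, - 1:] (CL_bracket b \<phi> y x))
          = cl_val (r + d) (\<lambda>\<beta>. cl_val (- r) (\<lambda>\<alpha>. CL_num b \<phi> \<beta> \<alpha> (- r - d) d * \<xi> (\<beta> + \<alpha>)) x) y"
      proof -
        have "poly [:- r, - 1:] d = - r - d" "- (- r - d) = r + d" "- r - d + d = - r" by simp_all
        then show ?thesis by (simp only: cl_val_bracket)
      qed
      also have "\<dots> = cl_val (r + d) (\<lambda>\<beta>. - cl_val (- r) (\<lambda>\<alpha>. CL_num b \<phi> \<alpha> \<beta> r d * \<xi> (\<alpha> + \<beta>)) x) y"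
        by (simp add: CL_num_skew add.commute cl_val_fun_minus)
      also have "\<dots> = - cl_val (r + d) (\<lambda>\<beta>. cl_val (- r) (\<lambda>\<alpha>. CL_num b \<phi> \<alpha> \<beta> r d * \<xi> (\<alpha> + \<beta>)) x) y"
        by (rule cl_val_fun_minus)
      also have "cl_val (r + d) (\<lambda>\<beta>. cl_val (- r) (\<lambda>\<alpha>. CL_num b \<phi> \<alpha> \<beta> r d * \<xi> (\<alpha> + \<beta>)) x) y
          = cl_val (- r) (\<lambda>\<alpha>. cl_val (r + d) (\<lambda>\<beta>. CL_num b \<phi> \<alpha> \<beta> r d * \<xi> (\<alpha> + \<beta>)) y) x"
        by (rule cl_val_swap)
      finally show ?thesis by (simp add: cl_val_bracket)
    qed
    ultimately show "cl_val d \<xi> (pev CL_scale [:r:] (CL_bracket b \<phi> x y)) =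
        cl_val d \<xi> (pev CL_scale [:r:] (- psubst (\<lambda>P. - lam P - map_poly (CL_scale [:0, 1:]) P)
          (\<lambda>d. [:d:]) (CL_bracket b \<phi> y x)))"
      by (simp add: cl.pev_minus cl_val_minus)
  qed
  show "psubst mu (\<lambda>d. psubst2 lam (lca_bracket ?R x d)) (lca_bracket ?R y z)
      = psubst lam (\<lambda>d. psubst2 (\<lambda>P. lam P + mu P) (lca_bracket ?R d z)) (lca_bracket ?R x y)
      + psubst lam (\<lambda>d. psubst2 mu (lca_bracket ?R y d)) (lca_bracket ?R x z)"
    if xyz: "x \<in> ?C" "y \<in> ?C" "z \<in> ?C"
    unfolding br
  proof (intro cl.pev2_inject cl_eqI)
    fix r s d :: complex and \<xi>
    let ?G = "CL_num b \<phi>"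
    have 1: "pev2 CL_scale r s (lam P + mu P) = CL_scale [:r + s:] (pev2 CL_scale r s P)" for P
    proof -
      have "[:r + s:] = [:r:] + [:s:]" by simp
      then show ?thesis
        by (simp only: cl.pev2_add cl.pev2_lam cl.pev2_mu cl.scale_left_distrib)
    qed
    have left: "(\<Sum>k\<le>degree (CL_bracket b \<phi> g h). u ^ k *
          cl_val d \<xi> (pev CL_scale [:t:] (CL_bracket b \<phi> f (coeff (CL_bracket b \<phi> g h) k))))
        = cl_val (- t) (\<lambda>\<alpha>. cl_val (- u) (\<lambda>\<beta>. cl_val (u + (t + d))
            (\<lambda>\<gamma>. ?G \<beta> \<gamma> u (t + d) * (?G \<alpha> (\<beta> + \<gamma>) t d * \<xi> (\<alpha> + (\<beta> + \<gamma>)))) h) g) f"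
      for f g h t u
      by (simp add: cl_val_bracket cl_val_fun_sum cl_val_bracket_sum)
    have right: "(\<Sum>k\<le>degree (CL_bracket b \<phi> f g). u ^ k *
          cl_val d \<xi> (pev CL_scale [:t:] (CL_bracket b \<phi> (coeff (CL_bracket b \<phi> f g) k) h)))
        = cl_val (- u) (\<lambda>\<alpha>. cl_val (u - t) (\<lambda>\<beta>. cl_val (t + d)
            (\<lambda>\<gamma>. ?G \<alpha> \<beta> u (- t) * (?G (\<alpha> + \<beta>) \<gamma> t d * \<xi> (\<alpha> + \<beta> + \<gamma>))) h) g) f"
      for f g h t u
      by (simp add: cl_val_bracket cl_val_bracket_sum cl_val_fun_mult)
    have L: "cl_val d \<xi> (pev2 CL_scale r s (psubst mu (\<lambda>d. psubst2 lam (CL_bracket b \<phi> x d))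
          (CL_bracket b \<phi> y z)))
        = cl_val (- r) (\<lambda>\<alpha>. cl_val (- s) (\<lambda>\<beta>. cl_val (r + s + d)
            (\<lambda>\<gamma>. ?G \<beta> \<gamma> s (r + d) * ?G \<alpha> (\<beta> + \<gamma>) r d * \<xi> (\<alpha> + \<beta> + \<gamma>)) z) y) x"
      unfolding cl.pev2_psubst[OF cl.pev2_mu] cl.pev2_psubst2[OF cl.pev2_lam]
      by (simp add: cl_val_sum cl_val_scale left add.assoc add.left_commute mult.assoc)
    have R2: "cl_val d \<xi> (pev2 CL_scale r s (psubst lam (\<lambda>d. psubst2 mu (CL_bracket b \<phi> y d))
          (CL_bracket b \<phi> x z)))
        = cl_val (- r) (\<lambda>\<alpha>. cl_val (- s) (\<lambda>\<beta>. cl_val (r + s + d)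
            (\<lambda>\<gamma>. ?G \<alpha> \<gamma> r (s + d) * ?G \<beta> (\<alpha> + \<gamma>) s d * \<xi> (\<alpha> + \<beta> + \<gamma>)) z) y) x"
    proof -
      have "cl_val d \<xi> (pev2 CL_scale r s (psubst lam (\<lambda>d. psubst2 mu (CL_bracket b \<phi> y d))
            (CL_bracket b \<phi> x z)))
          = cl_val (- s) (\<lambda>\<beta>. cl_val (- r) (\<lambda>\<alpha>. cl_val (r + s + d)
              (\<lambda>\<gamma>. ?G \<alpha> \<gamma> r (s + d) * ?G \<beta> (\<alpha> + \<gamma>) s d * \<xi> (\<alpha> + \<beta> + \<gamma>)) z) x) y"
        unfolding cl.pev2_psubst[OF cl.pev2_lam] cl.pev2_psubst2[OF cl.pev2_mu]
        by (simp add: cl_val_sum cl_val_scale left add.assoc add.left_commute mult.assoc)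
      also have "\<dots> = cl_val (- r) (\<lambda>\<alpha>. cl_val (- s) (\<lambda>\<beta>. cl_val (r + s + d)
            (\<lambda>\<gamma>. ?G \<alpha> \<gamma> r (s + d) * ?G \<beta> (\<alpha> + \<gamma>) s d * \<xi> (\<alpha> + \<beta> + \<gamma>)) z) y) x"
        by (rule cl_val_swap)
      finally show ?thesis .
    qed
    have R1: "cl_val d \<xi> (pev2 CL_scale r s (psubst lam (\<lambda>d. psubst2 (\<lambda>P. lam P + mu P)
          (CL_bracket b \<phi> d z)) (CL_bracket b \<phi> x y)))
        = cl_val (- r) (\<lambda>\<alpha>. cl_val (- s) (\<lambda>\<beta>. cl_val (r + s + d)
            (\<lambda>\<gamma>. ?G \<alpha> \<beta> r (- (r + s)) * ?G (\<alpha> + \<beta>) \<gamma> (r + s) d * \<xi> (\<alpha> + \<beta> + \<gamma>)) z) y) x"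
      unfolding cl.pev2_psubst[OF cl.pev2_lam] cl.pev2_psubst2[OF 1]
      by (simp add: cl_val_sum cl_val_scale right mult.assoc)
    show "cl_val d \<xi> (pev2 CL_scale r s (psubst mu (\<lambda>d. psubst2 lam (CL_bracket b \<phi> x d))
          (CL_bracket b \<phi> y z)))
        = cl_val d \<xi> (pev2 CL_scale r s (psubst lam (\<lambda>d. psubst2 (\<lambda>P. lam P + mu P)
            (CL_bracket b \<phi> d z)) (CL_bracket b \<phi> x y)
          + psubst lam (\<lambda>d. psubst2 mu (CL_bracket b \<phi> y d)) (CL_bracket b \<phi> x z)))"
      unfolding cl.pev2_add cl_val_add L R1 R2 cl_val_fun_add[symmetric]
    proof (intro cl_val_cong)
      fix \<alpha> \<beta> \<gamma>
      assume "\<alpha> \<in> Poly_Mapping.keys x" "\<beta> \<in> Poly_Mapping.keys y" "\<gamma> \<in> Poly_Mapping.keys z"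
      then have "\<alpha> \<in> D" "\<beta> \<in> D" "\<gamma> \<in> D" using xyz by (auto simp: C)
      then show "?G \<beta> \<gamma> s (r + d) * ?G \<alpha> (\<beta> + \<gamma>) r d * \<xi> (\<alpha> + \<beta> + \<gamma>) =
          ?G \<alpha> \<beta> r (- (r + s)) * ?G (\<alpha> + \<beta>) \<gamma> (r + s) d * \<xi> (\<alpha> + \<beta> + \<gamma>)
          + ?G \<alpha> \<gamma> r (s + d) * ?G \<beta> (\<alpha> + \<gamma>) s d * \<xi> (\<alpha> + \<beta> + \<gamma>)"
        using CL_num_jacobi[of b \<phi> \<alpha> \<beta> \<gamma> s r d] b \<phi> by (simp flip: distrib_right)
    qed
  qed
qed

lemma CL_bracket_generators:
  "CL_bracket b \<phi> (Poly_Mapping.single \<alpha> 1) (Poly_Mapping.single \<beta> 1)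
     = map_poly (Poly_Mapping.single (\<alpha> + \<beta>)) (CL_coeff b \<phi> \<alpha> \<beta>)"
proof -
  have "subst_del 1 q = 1" for q
    by (simp add: subst_del_def one_pCons map_poly_pCons)
  then show ?thesis by (simp add: CL_bracket_def)
qed

end

theory Submission
  imports Defs "HOL-Computational_Algebra.Fundamental_Theorem_Algebra"
begin

text \<open>
  Suppose that \<open>f\<close> embeds \<open>CL(b,\<phi>)\<close> into \<open>gc\<^sub>N\<close>, and let \<open>V = \<complex>[\<partial>]\<^sup>N\<close> and \<open>M\<^sub>\<alpha> = f x\<^sub>\<alpha>\<close>.  In terms of values
  at complex numbers, the bracket relations say
  \<open>[M\<^sub>\<alpha>(z), M\<^sub>\<beta>(u)] = ((\<beta> + b) z - (\<alpha> + b) u + const) M\<^bsub>\<alpha>+\<beta>\<^esub>(z + u)\<close>.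
  The element \<open>x\<^sub>0\<close> is \<open>b\<close> times a Virasoro element, and the \<open>\<lambda>\<close>-linear coefficient \<open>D\<close> of \<open>M\<^sub>0\<close> is
  \<open>b\<close> times the energy operator of a Virasoro action on \<open>V\<close>.  The idea is to compare
  the possible eigenvalues of \<open>D\<close> with the weights \<open>\<beta> + b - b m\<close> with which the coefficients of \<open>M\<^sub>\<beta>\<close>
  shift them (\<open>D_commutator\<close>).

  The space \<open>V\<close> is filtered by \<open>W\<^sub>n = {v. deg (M\<^sub>0 v) \<le> n}\<close>, with bottom \<open>K = {v. M\<^sub>0 v = 0}\<close>.
  The leading coefficients of all the polynomials \<open>M\<^sub>0 v\<close> lie in one finite-dimensional space
  (\<open>leading_coefficients_finite_dim\<close>), so \<open>D\<close> has a finite spectrum \<open>E\<close> on them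
  (\<open>leading_spectrum\<close>).  Since \<open>W\<^sub>n / W\<^bsub>n-1\<^esub>\<close> embeds into that space by the \<open>n\<close>-th coefficient, which
  changes weights by \<open>b (1 - n)\<close>, the spectrum of \<open>D\<close> on \<open>V / K\<close> is contained in
  \<open>E + b {-1, 0, 1, ...}\<close>, and on the part of \<open>V / K\<close> that contains the
  standard basis it is contained in \<open>E + b {-1, ..., N - 1}\<close> for a fixed \<open>N\<close>
  (\<open>spectrum_filtration\<close>).

  Each \<open>M\<^sub>\<beta>\<close> kills \<open>K\<close> (\<open>M_kills_K\<close>).  If its weights do not connect the two sets above, then it maps
  the standard basis, hence all of \<open>V\<close>, into \<open>K\<close>, so that \<open>M\<^sub>\<beta> M\<^sub>\<beta> = 0\<close>, and the relation for
  \<open>\<alpha> = \<beta>\<close> gives \<open>M\<^bsub>2\<beta>\<^esub> = 0\<close> because \<open>\<beta> + b \<noteq> 0\<close>.  Injectivity excludes this, so every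
  \<open>\<beta>\<close> in \<open>\<Delta>\<close> lies in \<open>(E - E) + b {k. k \<ge> - N - 1}\<close> (\<open>weight_constraint\<close>).  An additive group inside
  such a one-sided set is finite (\<open>finite_additive_subgrp\<close>).
\<close>

section \<open>Spectra of linear operators modulo a subspace\<close>

locale complex_operator = vector_space scale
  for scale :: "complex \<Rightarrow> 'v::ab_group_add \<Rightarrow> 'v" (infixr \<open>*\<^sub>s\<close> 75) +
  fixes D :: "'v \<Rightarrow> 'v"
  assumes D_add: "D (v + w) = D v + D w"
    and D_scale: "D (c *\<^sub>s v) = c *\<^sub>s D v"
begin

lemma D_diff: "D (v - w) = D v - D w"
proof -
  interpret additive D by unfold_locales (rule D_add)
  show ?thesis by (rule diff)
qed

lemma D_0: "D 0 = 0"
  using D_add[of 0 0] by simp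

text \<open>
  A vector satisfies \<open>spec_in Z S\<close> if some finite product of operators \<open>D - x\<close> with \<open>x \<in> S\<close> sends it
  into \<open>Z\<close>: when \<open>Z\<close> is an invariant subspace, it is a sum of generalised eigenvectors of \<open>D\<close>
  on the quotient by \<open>Z\<close>, with eigenvalues in \<open>S\<close>.  The inductive form gives induction
  over the factors without forming quotient spaces.
\<close>

inductive spec_in :: "'v set \<Rightarrow> complex set \<Rightarrow> 'v \<Rightarrow> bool" for Z S where
  base: "v \<in> Z \<Longrightarrow> spec_in Z S v"
| step: "x \<in> S \<Longrightarrow> spec_in Z S (D v - x *\<^sub>s v) \<Longrightarrow> spec_in Z S v"

lemma spec_in_mono: "spec_in Z S v \<Longrightarrow> S \<subseteq> S' \<Longrightarrow> spec_in Z S' v"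
  by (induction rule: spec_in.induct) (auto intro: spec_in.intros)

lemma spec_in_trans:
  assumes "spec_in Z S v" and "\<And>z. z \<in> Z \<Longrightarrow> spec_in Z' S' z"
  shows "spec_in Z' (S \<union> S') v"
  using assms(1)
proof induction
  case (base v)
  with assms(2) show ?case by (blast intro: spec_in_mono)
next
  case (step x v)
  then show ?case by (blast intro: spec_in.step)
qed

lemma factors_commute:
  "D (D v - x *\<^sub>s v) - y *\<^sub>s (D v - x *\<^sub>s v) = D (D v - y *\<^sub>s v) - x *\<^sub>s (D v - y *\<^sub>s v)"
  by (simp add: D_diff D_scale scale_right_diff_distrib mult.commute)

context
  fixes Z :: "'v set"
  assumes Z: "subspace Z" and DZ: "\<And>z. z \<in> Z \<Longrightarrow> D z \<in> Z"
begin

lemma spec_in_factor: "spec_in Z S v \<Longrightarrow> spec_in Z S (D v - x *\<^sub>s v)"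
proof (induction rule: spec_in.induct)
  case (base v)
  then show ?case by (intro spec_in.base subspace_diff subspace_scale Z DZ)
next
  case (step y v)
  then show ?case using factors_commute[of v x y] by (auto intro: spec_in.step)
qed

lemma spec_in_add:
  assumes "spec_in Z S v" "spec_in Z S w"
  shows "spec_in Z S (v + w)"
  using assms
proof (induction arbitrary: w rule: spec_in.induct)
  case (base v)
  from base(2) base(1) show ?case
  proof (induction arbitrary: v rule: spec_in.induct)
    case (base w)
    then show ?case by (blast intro: spec_in.base subspace_add[OF Z])
  next
    case (step x w)
    have "D v - x *\<^sub>s v \<in> Z" using step.prems by (intro subspace_diff subspace_scale Z DZ)
    from step.IH[OF this] have "spec_in Z S (D (v + w) - x *\<^sub>s (v + w))"
      by (simp add: D_add scale_right_distrib algebra_simps)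
    with step.hyps(1) show ?case by (rule spec_in.step)
  qed
next
  case (step x v)
  from step.IH[OF spec_in_factor[OF step.prems, of x]]
  have "spec_in Z S (D (v + w) - x *\<^sub>s (v + w))"
    by (simp add: D_add scale_right_distrib algebra_simps)
  with step.hyps(1) show ?case by (rule spec_in.step)
qed

lemma spec_in_scale: "spec_in Z S v \<Longrightarrow> spec_in Z S (c *\<^sub>s v)"
proof (induction rule: spec_in.induct)
  case (base v)
  then show ?case by (intro spec_in.base subspace_scale Z)
next
  case (step x v)
  have "c *\<^sub>s (D v - x *\<^sub>s v) = D (c *\<^sub>s v) - x *\<^sub>s (c *\<^sub>s v)"
    by (simp add: D_scale scale_right_diff_distrib mult.commute)
  with step.IH show ?case using step.hyps(1) by (auto intro: spec_in.step)
qed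

lemma spec_in_eigenvalue:
  assumes "spec_in Z S v" "v \<notin> Z" "D v - x *\<^sub>s v \<in> Z"
  shows "x \<in> S"
  using assms
proof induction
  case (base v)
  then show ?case by simp
next
  case (step y v)
  let ?u = "D v - y *\<^sub>s v"
  show ?case
  proof (cases "x = y")
    case True
    with step.hyps show ?thesis by simp
  next
    case False
    have "?u \<notin> Z"
    proof
      assume "?u \<in> Z"
      then have "?u - (D v - x *\<^sub>s v) \<in> Z" using step.prems(2) by (rule subspace_diff[OF Z])
      moreover have "?u - (D v - x *\<^sub>s v) = (x - y) *\<^sub>s v"
        by (simp add: scale_left_diff_distrib)
      ultimately have "inverse (x - y) *\<^sub>s (x - y) *\<^sub>s v \<in> Z"
        using subspace_scale[OF Z] by metis
      with False step.prems(1) show False by simp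
    qed
    moreover have "D ?u - x *\<^sub>s ?u \<in> Z"
      unfolding factors_commute[of v y x]
      by (intro subspace_diff subspace_scale Z DZ step.prems)
    ultimately show ?thesis by (rule step.IH)
  qed
qed

text \<open>
  Applying the factors \<open>D - x\<close> one after the other to a vector outside \<open>Z\<close> meets an eigenvector
  modulo \<open>Z\<close> just before \<open>Z\<close> is entered.  Its eigenvalue lies in both sets by
  \<open>spec_in_eigenvalue\<close>.
\<close>

lemma spec_in_disjoint:
  assumes "spec_in Z S v" "spec_in Z S' v" "S \<inter> S' = {}"
  shows "v \<in> Z"
  using assms
proof induction
  case (base v)
  then show ?case by simp
next
  case (step x v)
  have "D v - x *\<^sub>s v \<in> Z" by (intro step.IH spec_in_factor step.prems)
  with spec_in_eigenvalue[OF step.prems(1)] step.hyps(1) step.prems(2) show ?case by blast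
qed

end

lemma D_pow_add: "(D ^^ k) (v + w) = (D ^^ k) v + (D ^^ k) w"
  by (induction k) (simp_all add: D_add)

lemma D_pow_scale: "(D ^^ k) (c *\<^sub>s v) = c *\<^sub>s (D ^^ k) v"
  by (induction k) (simp_all add: D_scale)

definition op_poly :: "complex poly \<Rightarrow> 'v \<Rightarrow> 'v" where
  "op_poly p v = (\<Sum>k\<le>degree p. coeff p k *\<^sub>s (D ^^ k) v)"

lemma op_poly_bound:
  assumes "degree p \<le> n"
  shows "op_poly p v = (\<Sum>k\<le>n. coeff p k *\<^sub>s (D ^^ k) v)"
  unfolding op_poly_def using assms
  by (intro sum.mono_neutral_left) (auto simp: coeff_eq_0)

lemma op_poly_mult_linear: "op_poly ([:- x, 1:] * p) v = op_poly p (D v - x *\<^sub>s v)"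
proof -
  let ?n = "degree p"
  have "op_poly ([:- x, 1:] * p) v
      = (\<Sum>k\<le>Suc ?n. coeff (pCons 0 p) k *\<^sub>s (D ^^ k) v - (x * coeff p k) *\<^sub>s (D ^^ k) v)"
    by (subst op_poly_bound[where n = "Suc ?n"])
      (use degree_mult_le[of "[:- x, 1:]" p] in
        \<open>auto intro!: sum.cong simp: scale_left_diff_distrib\<close>)
  also have "\<dots> = (\<Sum>k\<le>Suc ?n. coeff (pCons 0 p) k *\<^sub>s (D ^^ k) v)
      - (\<Sum>k\<le>Suc ?n. (x * coeff p k) *\<^sub>s (D ^^ k) v)"
    by (rule sum_subtractf)
  also have "(\<Sum>k\<le>Suc ?n. coeff (pCons 0 p) k *\<^sub>s (D ^^ k) v)
      = (\<Sum>k\<le>?n. coeff p k *\<^sub>s (D ^^ k) (D v))"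
    by (subst sum.atMost_Suc_shift) (simp add: funpow_swap1)
  also have "(\<Sum>k\<le>Suc ?n. (x * coeff p k) *\<^sub>s (D ^^ k) v)
      = (\<Sum>k\<le>?n. (x * coeff p k) *\<^sub>s (D ^^ k) v)"
    by (simp add: coeff_eq_0)
  also have "(\<Sum>k\<le>?n. coeff p k *\<^sub>s (D ^^ k) (D v)) - (\<Sum>k\<le>?n. (x * coeff p k) *\<^sub>s (D ^^ k) v)
      = (\<Sum>k\<le>?n. coeff p k *\<^sub>s ((D ^^ k) (D v) - (D ^^ k) (x *\<^sub>s v)))"
    by (simp add: sum_subtractf scale_right_diff_distrib D_pow_scale mult.commute)
  also have "\<dots> = (\<Sum>k\<le>?n. coeff p k *\<^sub>s (D ^^ k) (D v - x *\<^sub>s v))"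
  proof -
    have "(D ^^ k) (u - w) = (D ^^ k) u - (D ^^ k) w" for k u w
      using D_pow_add[of k "u - w" w] by simp
    then show ?thesis by simp
  qed
  finally show ?thesis by (simp add: op_poly_def)
qed

text \<open>Over \<open>\<complex>\<close> the polynomial splits into linear factors, which are peeled off one by one.\<close>

lemma spec_in_op_poly:
  assumes "p \<noteq> 0" "op_poly p v = 0"
  shows "spec_in {0} {x. poly p x = 0} v"
  using assms
proof (induction "degree p" arbitrary: p v)
  case 0
  then obtain c where "p = [:c:]" "c \<noteq> 0"
    by (metis degree_eq_zeroE pCons_0_0)
  with 0 have "v = 0" by (simp add: op_poly_def)
  then show ?case by (simp add: spec_in.base)
next
  case (Suc n)
  then have "\<not> constant (poly p)" by (simp add: constant_degree)
  then obtain x where x: "poly p x = 0" using fundamental_theorem_of_algebra by blast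
  then obtain q where q: "p = [:- x, 1:] * q" unfolding poly_eq_0_iff_dvd by blast
  then have "q \<noteq> 0" using Suc.prems by auto
  then have "degree p = Suc (degree q)" unfolding q by (subst degree_mult_eq) auto
  with Suc.hyps(2) have "n = degree q" by simp
  moreover have "op_poly q (D v - x *\<^sub>s v) = 0"
    using Suc.prems(2) unfolding q op_poly_mult_linear .
  ultimately have "spec_in {0} {x. poly q x = 0} (D v - x *\<^sub>s v)"
    using \<open>q \<noteq> 0\<close> by (intro Suc.hyps(1))
  then have "spec_in {0} {x. poly p x = 0} (D v - x *\<^sub>s v)"
    by (rule spec_in_mono) (auto simp: q)
  with x show ?case by (auto intro: spec_in.step)
qed

text \<open>
  The \<open>card B + 1\<close> vectors \<open>v, D v, D\<^sup>2 v, ...\<close> in the span of \<open>B\<close> either repeat or are linearly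
  dependent.  Either way a nonzero polynomial in \<open>D\<close> kills \<open>v\<close>.
\<close>

lemma finite_spectrum_vector:
  assumes B: "finite B" and v: "\<And>k. (D ^^ k) v \<in> span B"
  shows "\<exists>S. finite S \<and> spec_in {0} S v"
proof -
  have "\<exists>p. p \<noteq> 0 \<and> op_poly p v = 0"
  proof (cases "inj_on (\<lambda>k. (D ^^ k) v) {..card B}")
    case False
    then obtain i j where ij: "i < j" "(D ^^ i) v = (D ^^ j) v"
      unfolding inj_on_def by (metis linorder_neqE_nat)
    let ?p = "monom 1 j - monom 1 i :: complex poly"
    have "coeff ?p j = 1" using ij by simp
    then have "?p \<noteq> 0" by (metis coeff_0 zero_neq_one)
    moreover have d: "degree ?p \<le> j"
      by (rule degree_le) (use ij in auto)
    then have "op_poly ?p v = (\<Sum>k\<le>j. (if k = j then (D ^^ k) v else 0) - (if k = i then (D ^^ k) v else 0))"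
      unfolding op_poly_bound[OF d] by (intro sum.cong) (auto simp: scale_left_diff_distrib)
    then have "op_poly ?p v = 0"
      using ij by (simp add: sum_subtractf)
    ultimately show ?thesis by blast
  next
    case True
    let ?A = "(\<lambda>k. (D ^^ k) v) ` {..card B}"
    have "card ?A = Suc (card B)" using True by (simp add: card_image)
    then have "dependent ?A"
      using independent_span_bound[OF B, of ?A] v by fastforce
    then obtain u where u: "(\<Sum>w\<in>?A. u w *\<^sub>s w) = 0" "\<exists>w\<in>?A. u w \<noteq> 0"
      unfolding dependent_finite[of ?A, simplified] by auto
    define p where "p = Abs_poly (\<lambda>k. if k \<le> card B then u ((D ^^ k) v) else 0)"
    have c: "coeff p = (\<lambda>k. if k \<le> card B then u ((D ^^ k) v) else 0)"
      unfolding p_def by (rule coeff_Abs_poly[where n = "card B"]) simp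
    then have "degree p \<le> card B" by (intro degree_le) simp
    then have "op_poly p v = (\<Sum>w\<in>?A. u w *\<^sub>s w)"
      by (simp add: op_poly_bound c sum.reindex[OF True])
    moreover have "p \<noteq> 0"
    proof
      assume "p = 0"
      then have "(if k \<le> card B then u ((D ^^ k) v) else 0) = 0" for k
        unfolding c[THEN fun_cong, symmetric] by simp
      then have "u ((D ^^ k) v) = 0" if "k \<le> card B" for k
        using that by metis
      with u(2) show False by auto
    qed
    ultimately show ?thesis using u(1) by auto
  qed
  then show ?thesis using spec_in_op_poly poly_roots_finite by blast
qed

text \<open>
  A maximal independent subset of \<open>Y\<close> is finite and spans \<open>Y\<close>, so the union of the spectra of its
  finitely many elements works for all of \<open>Y\<close>.
\<close>

lemma finite_spectrum:
  assumes B: "finite B" and Y: "Y \<subseteq> span B" and DY: "\<And>y. y \<in> Y \<Longrightarrow> D y \<in> Y"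
  shows "\<exists>S. finite S \<and> (\<forall>y\<in>Y. spec_in {0} S y)"
proof -
  obtain C where C: "C \<subseteq> Y" "independent C" "Y \<subseteq> span C"
    using maximal_independent_subset[of Y] by blast
  have fin: "finite C" using independent_span_bound[OF B C(2)] C(1) Y by blast
  have "(D ^^ k) y \<in> Y" if "y \<in> Y" for k y
    by (induction k) (simp_all add: that DY)
  then have "\<forall>c\<in>C. \<exists>S. finite S \<and> spec_in {0} S c"
    using C(1) Y by (intro ballI finite_spectrum_vector[OF B]) blast
  then obtain S where S: "\<And>c. c \<in> C \<Longrightarrow> finite (S c) \<and> spec_in {0} (S c) c" by metis
  let ?S = "\<Union>c\<in>C. S c"
  have "spec_in {0} ?S y" if "y \<in> span C" for y
    using that
  proof (induction rule: span_induct_alt)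
    case base
    then show ?case by (simp add: spec_in.base)
  next
    case (step c x y)
    then show ?case
      by (intro spec_in_add spec_in_scale subspace_single_0)
       (auto simp: D_0 intro: spec_in_mono[OF conjunct2[OF S]])
  qed
  with C(3) fin S show ?thesis by (intro exI[of _ ?S]) auto
qed

end

section \<open>Conformal linear maps\<close>

interpretation cv: vector_space "\<lambda>c (v :: 'n::finite cvec). [:c:] *s v"
proof
  fix a b :: complex and x y :: "'n cvec"
  show "[:a:] *s (x + y) = [:a:] *s x + [:a:] *s y" by (rule vector_add_ldistrib)
  show "[:a + b:] *s x = [:a:] *s x + [:b:] *s x" by (simp flip: vector_sadd_rdistrib)
  show "[:a:] *s ([:b:] *s x) = [:a * b:] *s x" by (simp add: vector_smult_assoc mult.commute)
  show "[:1:] *s x = x" by (simp flip: one_pCons)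
qed

lemma cvec_induct [case_names axis const del add]:
  fixes v :: "'n::finite cvec"
  assumes axis: "\<And>i. P (axis i 1)" and const: "\<And>c v. P v \<Longrightarrow> P ([:c:] *s v)"
    and del: "\<And>v. P v \<Longrightarrow> P ([:0, 1:] *s v)" and add: "\<And>v w. P v \<Longrightarrow> P w \<Longrightarrow> P (v + w)"
  shows "P v"
proof -
  have zero: "P 0" using const[OF axis, of 0] by simp
  have gen: "P (p *s axis i 1)" for p i
  proof (induction p)
    case 0
    show ?case using zero by simp
  next
    case (pCons c p)
    have "pCons c p = [:c:] + [:0, 1:] * p" by simp
    then have "pCons c p *s axis i 1
        = [:c:] *s axis i 1 + [:0, 1:] *s (p *s axis i (1 :: complex poly))"
      by (simp only: vector_sadd_rdistrib vector_smult_assoc)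
    then show ?case using add[OF const[OF axis] del[OF pCons.IH]] by simp
  qed
  have sum: "P (\<Sum>i\<in>I. v $ i *s axis i 1)" for I :: "'n set"
    by (induction I rule: infinite_finite_induct) (simp_all add: zero add gen)
  have "(\<Sum>i\<in>UNIV. v $ i *s axis i 1) = v"
    by (simp add: vec_eq_iff axis_def if_distrib[of "(*) _"] cong: if_cong)
  with sum[of UNIV] show ?thesis by simp
qed

lemma coeff_conformal:
  assumes "conformal_linear a"
  shows coeff_conformal_add: "coeff (a (v + w)) k = coeff (a v) k + coeff (a w) k"
    and coeff_conformal_const: "coeff (a ([:c:] *s v)) k = [:c:] *s coeff (a v) k"
    and coeff_conformal_del:
      "coeff (a ([:0, 1:] *s v)) k = [:0, 1:] *s coeff (a v) k + coeff (lam (a v)) k"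
  using assms unfolding conformal_linear_def by (simp_all add: coeff_map_poly)

text \<open>
  The substitution \<open>\<lambda> \<mapsto> \<lambda> - \<partial>\<close>.  For a conformal linear \<open>a\<close>, the composite of \<open>reflect\<close> and \<open>a\<close> turns
  multiplication by \<open>\<partial>\<close> into multiplication by \<open>\<lambda>\<close> (\<open>reflect_del\<close>).  Hence the coefficients
  of \<open>reflect (a v)\<close>, for all \<open>v\<close>, are spanned by those for the standard basis.
\<close>

definition reflect :: "'n::finite cvec poly \<Rightarrow> 'n cvec poly" where
  "reflect = psubst (\<lambda>P. lam P - map_poly ((*s) [:0, 1:]) P) (\<lambda>v. [:v:])"

lemma pev_reflect: "pev (*s) [:z:] (reflect P) = pev (*s) [:z, -1:] P"
proof -
  have 1: "pev (*s) [:z:] (lam P - map_poly ((*s) [:0, 1:]) P) = [:z, -1:] *s pev (*s) [:z:] P"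
    for P :: "'a cvec poly"
  proof -
    have "[:z, -1:] = [:z:] - [:0, 1 :: complex:]" by simp
    then show ?thesis
      by (simp only: cvec.pev_diff cvec.pev_map_scale cvec.pev_pCons add_0 vector_sub_rdistrib)
  qed
  show ?thesis
    unfolding reflect_def
      cvec.psubst_hom[where h = "pev (*s) [:z:]", OF cvec.pev_add 1]
    by (simp add: pev_def[of _ "[:z, -1:]"])
qed

lemma reflect_add: "reflect (P + Q) = reflect P + reflect Q"
  by (rule cvec.pev_inject) (simp only: pev_reflect cvec.pev_add)

lemma reflect_scale: "reflect (map_poly ((*s) p) P) = map_poly ((*s) p) (reflect P)"
  by (rule cvec.pev_inject) (simp only: pev_reflect cvec.pev_map_scale)

lemma reflect_del: "reflect (map_poly ((*s) [:0, 1:]) P + lam P) = lam (reflect P)"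
proof (rule cvec.pev_inject)
  fix z
  have "[:z:] = [:0, 1:] + [:z, -1 :: complex:]" by simp
  then have "[:z:] *s v = [:0, 1:] *s v + [:z, -1:] *s v" for v :: "'a cvec"
    by (simp only: vector_sadd_rdistrib)
  then show "pev (*s) [:z:] (reflect (map_poly ((*s) [:0, 1:]) P + lam P))
      = pev (*s) [:z:] (lam (reflect P))"
    by (simp only: pev_reflect cvec.pev_add cvec.pev_map_scale cvec.pev_pCons add_0)
qed

lemma reflect_pCons:
  "reflect (pCons v P) = [:v:] + lam (reflect P) - map_poly ((*s) [:0, 1:]) (reflect P)"
proof (rule cvec.pev_inject)
  fix z
  have "[:z, -1:] = [:z:] - [:0, 1 :: complex:]" by simp
  then have "[:z, -1:] *s w = [:z:] *s w - [:0, 1:] *s w" for w :: "'a cvec"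
    by (simp only: vector_sub_rdistrib)
  then show "pev (*s) [:z:] (reflect (pCons v P))
      = pev (*s) [:z:] ([:v:] + lam (reflect P) - map_poly ((*s) [:0, 1:]) (reflect P))"
    by (simp add: pev_reflect cvec.pev_add cvec.pev_diff del: map_poly_pCons)
qed

text \<open>The substitution \<open>\<lambda> \<mapsto> \<lambda> - \<partial>\<close> changes only the coefficients below the leading one.\<close>

lemma coeff_reflect_degree: "degree P \<le> n \<Longrightarrow> coeff (reflect P) n = coeff P n"
proof (induction P arbitrary: n)
  case 0
  show ?case by (simp add: reflect_def psubst_def)
next
  case (pCons v P)
  show ?case
  proof (cases "P = 0")
    case True
    then show ?thesis by (simp add: reflect_def psubst_def)
  next
    case False
    then obtain m where m: "n = Suc m" "degree P \<le> m"
      using pCons.prems by (cases n) auto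
    have "coeff P n = 0" using m by (intro coeff_eq_0) simp
    with m pCons.IH[of m] pCons.IH[of n] show ?thesis
      by (simp add: reflect_pCons coeff_map_poly)
  qed
qed

text \<open>
  Although \<open>v\<close> ranges over an infinite-dimensional space, the leading coefficients of \<open>a v\<close> are also
  coefficients of \<open>reflect (a v)\<close>, and those lie in a fixed finite-dimensional space.
\<close>

lemma leading_coefficients_finite_dim:
  fixes a :: "'n::finite cmap"
  assumes a: "conformal_linear a"
  shows "\<exists>B. finite B \<and> (\<forall>v n. degree (a v) \<le> n \<longrightarrow> coeff (a v) n \<in> cv.span B)"
proof -
  define B where "B = (\<Union>i. coeff (reflect (a (axis i 1))) ` {..degree (reflect (a (axis i 1)))})"
  have "\<forall>m. coeff (reflect (a v)) m \<in> cv.span B" for v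
  proof (induction v rule: cvec_induct)
    case (axis i)
    show ?case
    proof
      fix m
      let ?Q = "reflect (a (axis i 1))"
      show "coeff ?Q m \<in> cv.span B"
      proof (cases "m \<le> degree ?Q")
        case True
        then have "coeff ?Q m \<in> B" unfolding B_def by blast
        then show ?thesis by (rule cv.span_base)
      next
        case False
        then show ?thesis by (simp add: coeff_eq_0 cv.span_zero)
      qed
    qed
  next
    case (const c v)
    with a show ?case
      by (simp add: conformal_linear_def reflect_scale coeff_map_poly cv.span_scale)
  next
    case (del v)
    with a show ?case
      by (auto simp: conformal_linear_def reflect_del coeff_pCons cv.span_zero split: nat.split)
  next
    case (add v w)
    with a show ?case
      by (simp add: conformal_linear_def reflect_add cv.span_add)
  qed
  moreover have "finite B" by (simp add: B_def)
  ultimately show ?thesis by (metis coeff_reflect_degree)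
qed

text \<open>
  The derivative with respect to \<open>\<lambda>\<close>: it gives the linear term of the Taylor shift
  (\<open>coeff_shift_1\<close>), which is what extracts \<open>D\<close> from the commutation relations.
\<close>

definition vderiv :: "'n::finite cvec poly \<Rightarrow> 'n cvec poly" where
  "vderiv P = Abs_poly (\<lambda>k. [:of_nat (Suc k):] *s coeff P (Suc k))"

lemma coeff_vderiv: "coeff (vderiv P) k = [:of_nat (Suc k):] *s coeff P (Suc k)"
proof -
  have "coeff (vderiv P) = (\<lambda>k. [:of_nat (Suc k):] *s coeff P (Suc k))"
    unfolding vderiv_def by (rule coeff_Abs_poly[where n = "degree P"]) (simp add: coeff_eq_0)
  then show ?thesis by simp
qed

lemma vderiv_pCons: "vderiv (pCons v P) = P + lam (vderiv P)"
proof (rule poly_eqI)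
  fix k
  have "[:1 + c:] *s w = w + [:c:] *s w" for c and w :: "'a cvec"
    using cv.scale_left_distrib[of 1 c w] by simp
  from this[of "of_nat k"] show "coeff (vderiv (pCons v P)) k = coeff (P + lam (vderiv P)) k"
    by (cases k) (simp_all add: coeff_vderiv)
qed

definition shift :: "complex \<Rightarrow> 'n::finite cvec poly \<Rightarrow> 'n cvec poly" where
  "shift u = psubst (\<lambda>P. lam P + map_poly ((*s) [:u:]) P) (\<lambda>v. [:v:])"

lemma pev_shift: "pev (*s) [:z:] (shift u P) = pev (*s) [:z + u:] P"
proof -
  have 1: "pev (*s) [:z:] (lam P + map_poly ((*s) [:u:]) P) = [:z + u:] *s pev (*s) [:z:] P"
    for P :: "'a cvec poly"
    by (simp only: cvec.pev_add cvec.pev_map_scale cvec.pev_pCons add_0 cv.scale_left_distrib)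
  show ?thesis
    unfolding shift_def cvec.psubst_hom[where h = "pev (*s) [:z:]", OF cvec.pev_add 1]
    by (simp add: pev_def[of _ "[:z + u:]"])
qed

lemma shift_0: "shift u 0 = 0"
  by (simp add: shift_def psubst_def)

lemma shift_pCons: "shift u (pCons v P) = [:v:] + lam (shift u P) + map_poly ((*s) [:u:]) (shift u P)"
  by (rule cvec.pev_inject)
    (simp add: pev_shift cvec.pev_add cv.scale_left_distrib add.assoc)

lemma coeff_shift_0: "coeff (shift u P) 0 = pev (*s) [:u:] P"
  by (induction P) (simp_all add: shift_pCons coeff_map_poly shift_0)

lemma coeff_shift_1: "coeff (shift u P) 1 = pev (*s) [:u:] (vderiv P)"
proof (induction P)
  case 0
  have "vderiv (0 :: 'a cvec poly) = 0" by (rule poly_eqI) (simp add: coeff_vderiv)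
  then show ?case by (simp add: shift_0)
next
  case (pCons v P)
  then show ?case
    by (simp add: shift_pCons coeff_map_poly vderiv_pCons cvec.pev_add coeff_shift_0)
qed

section \<open>Actions of the relations of \<open>CL(b,\<phi>)\<close> by conformal linear maps\<close>

locale CL_action =
  fixes \<Delta> :: "complex set" and b :: complex and \<phi> :: "complex \<Rightarrow> complex"
    and M :: "complex \<Rightarrow> ('n::finite) cmap"
  assumes \<Delta>: "additive_subgrp \<Delta>"
    and b: "b \<notin> \<Delta>"
    and \<phi>: "\<And>\<alpha> \<beta>. \<alpha> \<in> \<Delta> \<Longrightarrow> \<beta> \<in> \<Delta> \<Longrightarrow> \<phi> (\<alpha> + \<beta>) = \<phi> \<alpha> + \<phi> \<beta>"
    and conformal: "\<And>\<alpha>. \<alpha> \<in> \<Delta> \<Longrightarrow> conformal_linear (M \<alpha>)"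
    and commutator: "\<And>\<alpha> \<beta> z u v. \<alpha> \<in> \<Delta> \<Longrightarrow> \<beta> \<in> \<Delta> \<Longrightarrow>
      val (M \<alpha>) z (val (M \<beta>) u v) - val (M \<beta>) u (val (M \<alpha>) z v)
        = [:CL_num b \<phi> \<alpha> \<beta> z (- (z + u)):] *s val (M (\<alpha> + \<beta>)) (z + u) v"
begin

lemma zero_mem: "0 \<in> \<Delta>" and add_mem: "\<alpha> \<in> \<Delta> \<Longrightarrow> \<beta> \<in> \<Delta> \<Longrightarrow> \<alpha> + \<beta> \<in> \<Delta>"
    and neg_mem: "\<alpha> \<in> \<Delta> \<Longrightarrow> - \<alpha> \<in> \<Delta>"
  using \<Delta> by (simp_all add: additive_subgrp_def)

lemma b_nonzero: "b \<noteq> 0" using b zero_mem by auto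

lemma \<phi>_0: "\<phi> 0 = 0" using \<phi>[OF zero_mem zero_mem] by simp

definition T :: "'n cvec \<Rightarrow> 'n cvec" where "T v = coeff (M 0 v) 0"
definition D :: "'n cvec \<Rightarrow> 'n cvec" where "D v = coeff (M 0 v) 1"
definition K :: "'n cvec set" where "K = {v. M 0 v = 0}"

lemma M0: "conformal_linear (M 0)" by (rule conformal[OF zero_mem])

sublocale complex_operator "\<lambda>c v. [:c:] *s v" D
  by unfold_locales
    (simp_all add: D_def coeff_conformal_add[OF M0] coeff_conformal_const[OF M0])

lemma subspace_K: "cv.subspace K"
  by (rule cv.subspaceI)
    (auto simp: K_def poly_eq_iff coeff_conformal_add[OF M0] coeff_conformal_const[OF M0]
      intro: coeff_conformal_const[OF M0, of 0 0, simplified])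

lemma del_K: "v \<in> K \<Longrightarrow> [:0, 1:] *s v \<in> K"
  by (simp add: K_def poly_eqI coeff_conformal_del[OF M0])

lemma commutator_0:
  assumes "\<beta> \<in> \<Delta>"
  shows "val (M 0) z (val (M \<beta>) u v) - val (M \<beta>) u (val (M 0) z v)
    = [:(\<beta> + b) * z - b * u - \<phi> \<beta>:] *s val (M \<beta>) (z + u) v"
proof -
  have "CL_num b \<phi> 0 \<beta> z (- (z + u)) = (\<beta> + b) * z - b * u - \<phi> \<beta>"
    using b_nonzero by (simp add: CL_num_def \<phi>_0 algebra_simps)
  with commutator[OF zero_mem assms, of z u v] show ?thesis by simp
qed

lemma pev_map_linear:
  assumes "\<And>v w. F (v + w) = F v + F w" and "\<And>c v. F ([:c:] *s v) = [:c:] *s F v"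
  shows "pev (*s) [:u:] (map_poly F P) = F (pev (*s) [:u:] (P :: 'n cvec poly))"
  by (rule cvec.pev_map_add[symmetric]) (simp_all add: assms const_power cvec.cmodule_axioms)

text \<open>
  The commutation relation with \<open>M\<^sub>0\<close> as an identity of polynomials in the first spectral variable.
  Its coefficients of degree 0 and 1 are the relations for \<open>T\<close> and \<open>D\<close>.
\<close>

lemma commutator_polynomial:
  assumes \<beta>: "\<beta> \<in> \<Delta>"
  shows "M 0 (val (M \<beta>) u v) - map_poly (val (M \<beta>) u) (M 0 v)
    = map_poly ((*s) [:\<beta> + b:]) (lam (shift u (M \<beta> v)))
      + map_poly ((*s) [:- b * u - \<phi> \<beta>:]) (shift u (M \<beta> v))"
proof (rule cvec.pev_inject)
  fix z
  have "pev (*s) [:z:] (map_poly (val (M \<beta>) u) (M 0 v)) = val (M \<beta>) u (val (M 0) z v)"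
    unfolding val_def[of "M 0"]
    by (rule pev_map_linear) (simp_all only: val_add val_const conformal[OF \<beta>])
  moreover have "[:(\<beta> + b) * z - b * u - \<phi> \<beta>:] *s w
      = [:\<beta> + b:] *s ([:z:] *s w) + [:- b * u - \<phi> \<beta>:] *s w" for w :: "'n cvec"
    unfolding cv.scale_scale cv.scale_left_distrib[symmetric] by (simp add: algebra_simps)
  ultimately show "pev (*s) [:z:] (M 0 (val (M \<beta>) u v) - map_poly (val (M \<beta>) u) (M 0 v))
    = pev (*s) [:z:] (map_poly ((*s) [:\<beta> + b:]) (lam (shift u (M \<beta> v)))
      + map_poly ((*s) [:- b * u - \<phi> \<beta>:]) (shift u (M \<beta> v)))"
    using commutator_0[OF \<beta>, of z u v]
    unfolding cvec.pev_diff cvec.pev_add cvec.pev_map_scale cvec.pev_pCons pev_shift val_def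
    by simp
qed

lemma T_linear: "T (v + w) = T v + T w" "T ([:c:] *s v) = [:c:] *s T v"
  by (simp_all add: T_def coeff_conformal_add[OF M0] coeff_conformal_const[OF M0])

lemma T_0: "T 0 = 0"
  using T_linear(1)[of 0 0] by simp

lemma T_commutator:
  assumes \<beta>: "\<beta> \<in> \<Delta>"
  shows "T (coeff (M \<beta> v) m) - coeff (M \<beta> (T v)) m
    = - ([:b:] *s coeff (lam (M \<beta> v)) m) - [:\<phi> \<beta>:] *s coeff (M \<beta> v) m"
proof -
  have "map_poly T (M \<beta> v) - M \<beta> (T v)
      = - map_poly ((*s) [:b:]) (lam (M \<beta> v)) - map_poly ((*s) [:\<phi> \<beta>:]) (M \<beta> v)"
  proof (rule cvec.pev_inject)
    fix u
    have "val (M \<beta>) u 0 = 0"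
      using val_const[OF conformal[OF \<beta>], of u 0 0] by simp
    then have "T (val (M \<beta>) u v) - val (M \<beta>) u (T v) = [:- b * u - \<phi> \<beta>:] *s val (M \<beta>) u v"
      using arg_cong[where f = "\<lambda>P. coeff P 0", OF commutator_polynomial[OF \<beta>, of u v]]
      by (simp add: T_def coeff_map_poly coeff_shift_0 val_def[of _ u v])
    moreover have "[:- b * u - \<phi> \<beta>:] *s w = - ([:b:] *s ([:u:] *s w)) - [:\<phi> \<beta>:] *s w" for w :: "'n cvec"
      by (simp only: mult_minus_left cv.scale_left_diff_distrib cv.scale_minus_left cv.scale_scale)
    ultimately show "pev (*s) [:u:] (map_poly T (M \<beta> v) - M \<beta> (T v))
        = pev (*s) [:u:] (- map_poly ((*s) [:b:]) (lam (M \<beta> v)) - map_poly ((*s) [:\<phi> \<beta>:]) (M \<beta> v))"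
      unfolding cvec.pev_diff cvec.pev_minus cvec.pev_map_scale cvec.pev_pCons
        pev_map_linear[of T, OF T_linear] val_def
      by simp
  qed
  from arg_cong[where f = "\<lambda>P. coeff P m", OF this] show ?thesis
    by (simp add: coeff_map_poly T_0)
qed

text \<open>
  Up to a term in the next coefficient, coefficient \<open>m\<close> of \<open>M \<beta>\<close> shifts the eigenvalues of \<open>D\<close>
  by \<open>\<beta> + b - b m\<close>.
\<close>

lemma D_commutator:
  assumes \<beta>: "\<beta> \<in> \<Delta>"
  shows "D (coeff (M \<beta> v) m) - coeff (M \<beta> (D v)) m
    = [:\<beta> + b - b * of_nat m:] *s coeff (M \<beta> v) m
      - [:\<phi> \<beta> * of_nat (Suc m):] *s coeff (M \<beta> v) (Suc m)"
proof -
  let ?P = "M \<beta> v"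
  have "map_poly D ?P - M \<beta> (D v)
      = map_poly ((*s) [:\<beta> + b:]) ?P - map_poly ((*s) [:b:]) (lam (vderiv ?P))
        - map_poly ((*s) [:\<phi> \<beta>:]) (vderiv ?P)"
  proof (rule cvec.pev_inject)
    fix u
    have "val (M \<beta>) u 0 = 0"
      using val_const[OF conformal[OF \<beta>], of u 0 0] by simp
    then have "D (val (M \<beta>) u v) - val (M \<beta>) u (D v)
        = [:\<beta> + b:] *s val (M \<beta>) u v + [:- b * u - \<phi> \<beta>:] *s pev (*s) [:u:] (vderiv ?P)"
      using arg_cong[where f = "\<lambda>P. coeff P 1", OF commutator_polynomial[OF \<beta>, of u v]]
      by (simp add: D_def coeff_map_poly coeff_shift_0 coeff_shift_1[simplified] val_def[of _ u v])
    moreover have "[:- b * u - \<phi> \<beta>:] *s w = - ([:b:] *s ([:u:] *s w)) - [:\<phi> \<beta>:] *s w" for w :: "'n cvec"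
      by (simp only: mult_minus_left cv.scale_left_diff_distrib cv.scale_minus_left cv.scale_scale)
    ultimately show "pev (*s) [:u:] (map_poly D ?P - M \<beta> (D v))
        = pev (*s) [:u:] (map_poly ((*s) [:\<beta> + b:]) ?P - map_poly ((*s) [:b:]) (lam (vderiv ?P))
            - map_poly ((*s) [:\<phi> \<beta>:]) (vderiv ?P))"
      unfolding cvec.pev_diff cvec.pev_minus cvec.pev_map_scale cvec.pev_pCons
        pev_map_linear[of D, OF D_add D_scale] val_def
      by simp
  qed
  from arg_cong[where f = "\<lambda>P. coeff P m", OF this]
  have "D (coeff ?P m) - coeff (M \<beta> (D v)) m
      = [:\<beta> + b:] *s coeff ?P m - [:b:] *s coeff (lam (vderiv ?P)) m
        - [:\<phi> \<beta>:] *s ([:of_nat (Suc m):] *s coeff ?P (Suc m))"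
    by (simp add: coeff_map_poly D_0 coeff_vderiv)
  moreover have "coeff (lam (vderiv ?P)) m = [:of_nat m:] *s coeff ?P m"
    by (cases m) (simp_all add: coeff_vderiv)
  ultimately show ?thesis
    by (simp only: cv.scale_scale cv.scale_left_diff_distrib)
qed

lemma coeff_M0_D:
  "coeff (M 0 (D v)) m = D (coeff (M 0 v) m) - [:b - b * of_nat m:] *s coeff (M 0 v) m"
  using D_commutator[OF zero_mem, of v m] by (simp add: \<phi>_0 algebra_simps)

lemma D_K: "v \<in> K \<Longrightarrow> D v \<in> K"
  by (simp add: K_def poly_eqI coeff_M0_D D_0)

lemma degree_M0_D: "degree (M 0 v) \<le> n \<Longrightarrow> degree (M 0 (D v)) \<le> n"
  by (rule degree_le) (simp add: coeff_M0_D coeff_eq_0 D_0)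

lemma M0_diff: "M 0 (v - w) = M 0 v - M 0 w" and M0_scale: "M 0 ([:c:] *s v) = map_poly ((*s) [:c:]) (M 0 v)"
proof -
  interpret additive "M 0" by unfold_locales (use M0 in \<open>simp add: conformal_linear_def\<close>)
  show "M 0 (v - w) = M 0 v - M 0 w" by (rule diff)
  show "M 0 ([:c:] *s v) = map_poly ((*s) [:c:]) (M 0 v)" using M0 by (simp add: conformal_linear_def)
qed

lemma leading_spectrum:
  "\<exists>E. finite E \<and> (\<forall>v n. degree (M 0 v) \<le> n \<longrightarrow> spec_in {0} E (coeff (M 0 v) n))"
proof -
  define Y where "Y = {coeff (M 0 v) n | v n. degree (M 0 v) \<le> n}"
  obtain B where B: "finite B" "\<And>v n. degree (M 0 v) \<le> n \<Longrightarrow> coeff (M 0 v) n \<in> cv.span B"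
    using leading_coefficients_finite_dim[OF M0] by blast
  have DY: "D y \<in> Y" if "y \<in> Y" for y
  proof -
    from that obtain v n where v: "y = coeff (M 0 v) n" "degree (M 0 v) \<le> n"
      by (auto simp: Y_def)
    let ?w = "D v + [:b - b * of_nat n:] *s v"
    have "D y = coeff (M 0 ?w) n"
      by (simp add: v(1) coeff_conformal_add[OF M0] coeff_conformal_const[OF M0] coeff_M0_D)
    moreover have "degree (M 0 ?w) \<le> n"
      by (rule degree_le)
        (use v(2) degree_M0_D[OF v(2)] in
          \<open>simp add: coeff_conformal_add[OF M0] coeff_conformal_const[OF M0] coeff_eq_0\<close>)
    ultimately show ?thesis by (auto simp: Y_def)
  qed
  have "Y \<subseteq> cv.span B" using B(2) by (auto simp: Y_def)
  from finite_spectrum[OF B(1) this DY]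
  obtain E where E: "finite E" "\<forall>y\<in>Y. spec_in {0} E y" by metis
  have "spec_in {0} E (coeff (M 0 v) n)" if "degree (M 0 v) \<le> n" for v n
    using E(2) that unfolding Y_def by blast
  with E(1) show ?thesis by blast
qed

text \<open>
  By \<open>coeff_M0_D\<close>, taking the \<open>n\<close>-th coefficient of \<open>M 0 v\<close> changes \<open>D\<close> by
  the scalar \<open>b - b n\<close>, so the eigenvalue \<open>\<epsilon>\<close> of \<open>D\<close> on leading coefficients corresponds
  to \<open>\<epsilon> + b (n - 1)\<close> on \<open>v\<close>.
\<close>

lemma spectrum_graded_piece:
  assumes "spec_in {0} E (coeff (M 0 v) n)" "degree (M 0 v) \<le> n"
  shows "spec_in {w. degree (M 0 w) \<le> n \<and> coeff (M 0 w) n = 0}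
    ((\<lambda>\<epsilon>. \<epsilon> + b * (of_nat n - 1)) ` E) v"
  using assms
proof (induction "coeff (M 0 v) n" arbitrary: v rule: spec_in.induct)
  case base
  then show ?case by (auto intro: spec_in.base)
next
  case (step \<epsilon>)
  let ?x = "\<epsilon> + b * (of_nat n - 1)"
  let ?w = "D v - [:?x:] *s v"
  have "coeff (M 0 ?w) n = D (coeff (M 0 v) n)
      - ([:b - b * of_nat n:] *s coeff (M 0 v) n + [:?x:] *s coeff (M 0 v) n)"
    by (simp add: M0_diff M0_scale coeff_map_poly coeff_M0_D)
  also have "\<dots> = D (coeff (M 0 v) n) - [:\<epsilon>:] *s coeff (M 0 v) n"
    unfolding cv.scale_left_distrib[symmetric] by (simp add: algebra_simps)
  finally have "D (coeff (M 0 v) n) - [:\<epsilon>:] *s coeff (M 0 v) n = coeff (M 0 ?w) n" ..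
  moreover have "degree (M 0 ?w) \<le> n"
    by (rule degree_le)
      (use step.prems degree_M0_D[OF step.prems] in
        \<open>simp add: M0_diff M0_scale coeff_map_poly coeff_eq_0\<close>)
  ultimately have "spec_in {w. degree (M 0 w) \<le> n \<and> coeff (M 0 w) n = 0}
    ((\<lambda>\<epsilon>. \<epsilon> + b * (of_nat n - 1)) ` E) ?w"
    by (intro step.hyps(3))
  then show ?case using step.hyps(1) by (auto intro: spec_in.step)
qed

definition weights :: "complex set \<Rightarrow> nat \<Rightarrow> complex set" where
  "weights E n = (\<Union>i\<le>n. (\<lambda>\<epsilon>. \<epsilon> + b * (of_nat i - 1)) ` E)"

lemma spectrum_filtration:
  assumes E: "\<And>v n. degree (M 0 v) \<le> n \<Longrightarrow> spec_in {0} E (coeff (M 0 v) n)"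
    and v: "degree (M 0 v) \<le> n"
  shows "spec_in K (weights E n) v"
proof -
  have drop: "P = 0 \<or> degree P < n" if "degree P \<le> n" "coeff P n = 0" for P :: "'n cvec poly" and n
    using that by (cases "degree P = n") auto
  show ?thesis
    using v
  proof (induction n arbitrary: v)
    case 0
    have "w \<in> K" if "degree (M 0 w) \<le> 0" "coeff (M 0 w) 0 = 0" for w
      using drop[OF that] by (simp add: K_def)
    with spectrum_graded_piece[OF E[OF 0] 0] have "spec_in K ((\<lambda>\<epsilon>. \<epsilon> + b * (of_nat 0 - 1)) ` E \<union> {}) v"
      by (elim spec_in_trans) (auto intro: spec_in.base)
    then show ?case by (simp add: weights_def)
  next
    case (Suc n)
    have "degree (M 0 w) \<le> n" if "degree (M 0 w) \<le> Suc n" "coeff (M 0 w) (Suc n) = 0" for w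
      using drop[OF that] by auto
    with spectrum_graded_piece[OF E[OF Suc.prems] Suc.prems] Suc.IH
    have "spec_in K ((\<lambda>\<epsilon>. \<epsilon> + b * (of_nat (Suc n) - 1)) ` E \<union> weights E n) v"
      by (elim spec_in_trans) auto
    then show ?case by (simp add: weights_def atMost_Suc)
  qed
qed

text \<open>
  For \<open>v \<in> K\<close> the relation for \<open>T\<close> reads \<open>T (M\<^sub>\<beta>(u) v) = - (b u + \<phi>(\<beta>)) M\<^sub>\<beta>(u) v\<close>.  The right side
  has larger degree in \<open>u\<close> than the left one, unless \<open>M\<^sub>\<beta> v = 0\<close>.
\<close>

lemma M_kills_K:
  assumes \<beta>: "\<beta> \<in> \<Delta>" and v: "v \<in> K"
  shows "M \<beta> v = 0"
proof (rule ccontr)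
  assume nz: "M \<beta> v \<noteq> 0"
  let ?n = "degree (M \<beta> v)"
  have "T v = 0" using v by (simp add: K_def T_def)
  moreover have "M \<beta> 0 = 0"
    using conformal[OF \<beta>] unfolding conformal_linear_def by (metis add_cancel_right_right add_0)
  ultimately have "[:b:] *s lead_coeff (M \<beta> v) = 0"
    using T_commutator[OF \<beta>, of v "Suc ?n"] by (simp add: coeff_eq_0 T_0)
  with b_nonzero nz show False by simp
qed

text \<open>
  The assumption on the higher coefficients absorbs the \<open>\<phi>\<close>-term of \<open>D_commutator\<close> into \<open>K\<close>.  The
  lemma is therefore applied to the coefficients in descending order.
\<close>

lemma spectrum_image:
  assumes \<beta>: "\<beta> \<in> \<Delta>" and "spec_in K S v" and "\<And>m. m > n \<Longrightarrow> coeff (M \<beta> v) m \<in> K"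
  shows "spec_in K ((\<lambda>x. x + (\<beta> + b - b * of_nat n)) ` S) (coeff (M \<beta> v) n)"
  using assms(2,3)
proof (induction rule: spec_in.induct)
  case (base v)
  then show ?case by (simp add: M_kills_K[OF \<beta>] spec_in.base cv.subspace_0[OF subspace_K])
next
  case (step x v)
  note c = conformal[OF \<beta>]
  let ?w = "D v - [:x:] *s v"
  let ?y = "\<lambda>m. coeff (M \<beta> v) m"
  let ?s = "\<lambda>m. \<beta> + b - b * of_nat m"
  have diff: "coeff (M \<beta> ?w) m = coeff (M \<beta> (D v)) m - [:x:] *s ?y m" for m
    using coeff_conformal_add[OF c, of ?w "[:x:] *s v" m]
    by (simp add: coeff_conformal_const[OF c])
  have w: "coeff (M \<beta> ?w) m
      = D (?y m) - [:x + ?s m:] *s ?y m + [:\<phi> \<beta> * of_nat (Suc m):] *s ?y (Suc m)" for m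
    using D_commutator[OF \<beta>, of v m] cv.scale_left_distrib[of x "?s m" "?y m"]
    unfolding diff by (simp add: algebra_simps)
  have "coeff (M \<beta> ?w) m \<in> K" if "m > n" for m
    unfolding w using that step.prems
    by (intro cv.subspace_add cv.subspace_diff cv.subspace_scale subspace_K D_K) auto
  then have "spec_in K ((\<lambda>x. x + ?s n) ` S) (coeff (M \<beta> ?w) n)" by (rule step.IH)
  moreover have "spec_in K ((\<lambda>x. x + ?s n) ` S) (- ([:\<phi> \<beta> * of_nat (Suc n):] *s ?y (Suc n)))"
    by (intro spec_in.base cv.subspace_neg cv.subspace_scale subspace_K step.prems) simp
  ultimately have "spec_in K ((\<lambda>x. x + ?s n) ` S)
      (coeff (M \<beta> ?w) n + - ([:\<phi> \<beta> * of_nat (Suc n):] *s ?y (Suc n)))"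
    by (rule spec_in_add[OF subspace_K, rotated 1]) (rule D_K)
  then have "spec_in K ((\<lambda>x. x + ?s n) ` S) (D (?y n) - [:x + ?s n:] *s ?y n)"
    unfolding w by (simp del: of_nat_Suc)
  moreover have "x + ?s n \<in> (\<lambda>x. x + ?s n) ` S" using step.hyps(1) by (rule imageI)
  ultimately show ?case by (rule spec_in.step[rotated])
qed

text \<open>
  As \<open>M \<beta>\<close> kills \<open>K\<close>, all products \<open>M\<^sub>\<beta>(z) M\<^sub>\<beta>(u)\<close> vanish, and so does their commutator
  \<open>(\<beta> + b) (z - u) M\<^bsub>2\<beta>\<^esub>(z + u)\<close>.
\<close>

lemma M_image_in_K:
  assumes \<beta>: "\<beta> \<in> \<Delta>" and im: "\<And>v m. coeff (M \<beta> v) m \<in> K"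
  shows "M (\<beta> + \<beta>) = 0"
proof (rule cmap_eqI)
  fix w :: complex and v
  have "val (M \<beta>) u v \<in> K" for u v
    unfolding val_def pev_def const_power
    by (intro cv.subspace_sum cv.subspace_scale subspace_K im)
  then have square: "val (M \<beta>) z (val (M \<beta>) u v) = 0" for z u v
    by (simp add: val_def[of _ z] M_kills_K[OF \<beta>])
  \<comment> \<open>chosen so that \<open>z + u = w\<close> and \<open>z - u = 1\<close>\<close>
  let ?z = "(w + 1) / 2" and ?u = "(w - 1) / 2"
  have "CL_num b \<phi> \<beta> \<beta> ?z (- (?z + ?u)) = \<beta> + b"
    by (simp add: CL_num_def field_simps)
  moreover have "?z + ?u = w" by (simp add: field_simps)
  ultimately have "[:\<beta> + b:] *s val (M (\<beta> + \<beta>)) w v = 0"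
    using commutator[OF \<beta> \<beta>, of ?z ?u v] by (simp add: square)
  moreover have "\<beta> + b \<noteq> 0" using neg_mem[OF \<beta>] b by (metis add_eq_0_iff)
  ultimately show "val (M (\<beta> + \<beta>)) w v = val 0 w v" by simp
qed

text \<open>
  It is enough to test \<open>M \<beta>\<close> on the standard basis, whose weights come from the filtration degrees
  up to a fixed \<open>N\<close>.  A larger degree of the target, or a higher coefficient of \<open>M \<beta>\<close>, only increases
  \<open>k\<close>, which is why \<open>k\<close> is bounded below.
\<close>

lemma weight_constraint:
  "\<exists>F N. finite F \<and> (\<forall>\<beta>\<in>\<Delta>. M (\<beta> + \<beta>) \<noteq> 0 \<longrightarrow> (\<exists>c\<in>F. \<exists>k::int. k \<ge> - N \<and> \<beta> = c + b * of_int k))"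
proof -
  obtain E where E: "finite E" "\<And>v n. degree (M 0 v) \<le> n \<Longrightarrow> spec_in {0} E (coeff (M 0 v) n)"
    using leading_spectrum by blast
  define N where "N = Max (range (\<lambda>i. degree (M 0 (axis i 1))))"
  have N: "degree (M 0 (axis i 1)) \<le> N" for i unfolding N_def by (rule Max_ge) auto
  let ?F = "(\<lambda>(x, y). x - y) ` (E \<times> E)"
  have "\<exists>c\<in>?F. \<exists>k::int. k \<ge> - int (Suc N) \<and> \<beta> = c + b * of_int k"
    if \<beta>: "\<beta> \<in> \<Delta>" and nz: "M (\<beta> + \<beta>) \<noteq> 0" for \<beta>
  proof (rule ccontr)
    assume no: "\<not> (\<exists>c\<in>?F. \<exists>k::int. k \<ge> - int (Suc N) \<and> \<beta> = c + b * of_int k)"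
    have disjoint: "(\<lambda>x. x + (\<beta> + b - b * of_nat m)) ` weights E N \<inter> weights E n = {}" for m n
    proof (rule ccontr)
      assume "(\<lambda>x. x + (\<beta> + b - b * of_nat m)) ` weights E N \<inter> weights E n \<noteq> {}"
      then obtain \<epsilon> \<epsilon>' i j where *: "\<epsilon> \<in> E" "\<epsilon>' \<in> E" "i \<le> N"
        "\<epsilon>' + b * (of_nat i - 1) + (\<beta> + b - b * of_nat m) = \<epsilon> + b * (of_nat j - 1)"
        unfolding weights_def by blast
      then have "\<beta> = (\<epsilon> - \<epsilon>') + b * of_int (int j + int m - int i - 1)"
        by (simp add: algebra_simps)
      moreover have "\<epsilon> - \<epsilon>' \<in> ?F" using * by auto
      moreover have "int j + int m - int i - 1 \<ge> - int (Suc N)" using * by simp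
      ultimately show False using no by blast
    qed
    have "\<forall>m. coeff (M \<beta> v) m \<in> K" for v
    proof (induction v rule: cvec_induct)
      case (axis i)
      have v: "spec_in K (weights E N) (axis i 1)" by (rule spectrum_filtration[OF E(2) N])
      have step: "coeff (M \<beta> (axis i 1)) m \<in> K" if "\<And>k. k > m \<Longrightarrow> coeff (M \<beta> (axis i 1)) k \<in> K" for m
        using spectrum_image[OF \<beta> v that] spectrum_filtration[OF E(2) order_refl] disjoint
        by (rule spec_in_disjoint[OF subspace_K D_K, rotated 1])
      show ?case
      proof
        fix m
        show "coeff (M \<beta> (axis i 1)) m \<in> K"
        proof (induction "Suc (degree (M \<beta> (axis i 1))) - m" arbitrary: m rule: less_induct)
          case less
          show ?case
          proof (cases "m \<le> degree (M \<beta> (axis i 1))")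
            case True
            then show ?thesis by (blast intro: step[of m] less diff_less_mono2 le_imp_less_Suc)
          next
            case False
            then show ?thesis by (simp add: coeff_eq_0 cv.subspace_0[OF subspace_K])
          qed
        qed
      qed
    next
      case (const c v)
      then show ?case
        by (simp add: coeff_conformal_const[OF conformal[OF \<beta>]] cv.subspace_scale[OF subspace_K])
    next
      case (del v)
      then show ?case
        by (auto simp: coeff_conformal_del[OF conformal[OF \<beta>]] coeff_pCons split: nat.split
            intro!: cv.subspace_add[OF subspace_K] del_K cv.subspace_0[OF subspace_K])
    next
      case (add v w)
      then show ?case
        by (simp add: coeff_conformal_add[OF conformal[OF \<beta>]] cv.subspace_add[OF subspace_K])
    qed
    with M_image_in_K[OF \<beta>] nz show False by blast
  qed
  moreover have "finite ?F" using E(1) by blast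
  ultimately show ?thesis by (intro exI[of _ ?F] exI[of _ "int (Suc N)"]) blast
qed

end

section \<open>Homomorphisms from \<open>CL(b,\<phi>)\<close> to \<open>gc\<^sub>N\<close>\<close>

text \<open>
  The real part of \<open>\<beta> / b\<close> is bounded below on \<open>\<Delta>\<close>.  Applied to all multiples of \<open>\<beta>\<close> and of \<open>-\<beta>\<close> this forces it
  to vanish, and then \<open>c\<close> determines \<open>k\<close>.
\<close>

lemma finite_additive_subgrp:
  fixes \<Delta> F :: "complex set" and N :: int
  assumes \<Delta>: "additive_subgrp \<Delta>" and F: "finite F" and b: "b \<noteq> 0"
    and cover: "\<And>\<beta>. \<beta> \<in> \<Delta> \<Longrightarrow> \<exists>c\<in>F. \<exists>k::int. k \<ge> - N \<and> \<beta> = c + b * of_int k"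
  shows "finite \<Delta>"
proof -
  define m where "m = Min (insert 0 ((\<lambda>c. Re (c / b)) ` F)) - real_of_int N"
  have bound: "Re (\<beta> / b) \<ge> m" if "\<beta> \<in> \<Delta>" for \<beta>
  proof -
    obtain c k where c: "c \<in> F" "k \<ge> - N" "\<beta> = c + b * of_int k" using cover[OF \<open>\<beta> \<in> \<Delta>\<close>] by blast
    have "Re (\<beta> / b) = Re (c / b) + real_of_int k" using b c(3) by (simp add: add_divide_distrib)
    moreover have "Min (insert 0 ((\<lambda>c. Re (c / b)) ` F)) \<le> Re (c / b)" using F c(1) by simp
    moreover have "real_of_int k \<ge> - real_of_int N" using c(2) by (metis of_int_le_iff of_int_minus)
    ultimately show ?thesis by (simp add: m_def)
  qed
  have mult: "of_nat j * \<beta> \<in> \<Delta>" if "\<beta> \<in> \<Delta>" for j \<beta>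
    using that \<Delta> by (induction j) (auto simp: additive_subgrp_def distrib_right)
  have nonneg: "Re (\<beta> / b) \<ge> 0" if "\<beta> \<in> \<Delta>" for \<beta>
  proof (rule ccontr)
    assume neg: "\<not> Re (\<beta> / b) \<ge> 0"
    then have "0 < - Re (\<beta> / b)" by simp
    from reals_Archimedean3[OF this] obtain j :: nat where "- m < real j * - Re (\<beta> / b)" by blast
    moreover have "Re (of_nat j * \<beta> / b) = real j * Re (\<beta> / b)"
    proof -
      have "of_nat j * \<beta> / b = complex_of_real (real j) * (\<beta> / b)" by simp
      then show ?thesis by (simp only: times_complex.sel Re_complex_of_real Im_complex_of_real)
    qed
    ultimately show False using bound[OF mult[OF that], of j] by simp
  qed
  have zero: "Re (\<beta> / b) = 0" if "\<beta> \<in> \<Delta>" for \<beta>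
    using nonneg[OF that] nonneg[of "- \<beta>"] that \<Delta> by (simp add: additive_subgrp_def)
  have "\<Delta> \<subseteq> (\<lambda>c. c - b * of_real (Re (c / b))) ` F"
  proof
    fix \<beta> assume \<beta>: "\<beta> \<in> \<Delta>"
    obtain c k where c: "c \<in> F" "\<beta> = c + b * of_int k" using cover[OF \<beta>] by blast
    have "Re (\<beta> / b) = Re (c / b) + real_of_int k" using b c(2) by (simp add: add_divide_distrib)
    then have "real_of_int k = - Re (c / b)" using zero[OF \<beta>] by simp
    then have "of_int k = - complex_of_real (Re (c / b))"
      by (metis of_real_minus of_real_of_int_eq)
    with c show "\<beta> \<in> (\<lambda>c. c - b * of_real (Re (c / b))) ` F" by auto
  qed
  with F show ?thesis by (meson finite_imageI finite_subset)
qed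

text \<open>
  The homomorphism is additive on the carrier only, so its evaluation is taken along
  \<open>p \<mapsto> f (p x\<^bsub>\<alpha>+\<beta>\<^esub>)\<close>, which is additive on all of \<open>\<complex>[\<partial>]\<close>.  Evaluating the second variable at \<open>z + u\<close>
  turns \<open>\<partial>\<close> into \<open>-(z + u)\<close>.
\<close>

lemma CL_hom_commutator:
  fixes f :: "(complex \<Rightarrow>\<^sub>0 complex poly) \<Rightarrow> ('n::finite) cmap"
  assumes f: "lca_hom (CL \<Delta> b \<phi>) gc f" and \<Delta>: "additive_subgrp \<Delta>"
    and \<alpha>: "\<alpha> \<in> \<Delta>" and \<beta>: "\<beta> \<in> \<Delta>"
  defines "M \<equiv> \<lambda>\<alpha>. f (Poly_Mapping.single \<alpha> 1)"
  shows "val (M \<alpha>) z (val (M \<beta>) u v) - val (M \<beta>) u (val (M \<alpha>) z v)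
    = [:CL_num b \<phi> \<alpha> \<beta> z (- (z + u)):] *s val (M (\<alpha> + \<beta>)) (z + u) v"
proof -
  let ?S = "\<lambda>\<gamma> p. Poly_Mapping.single \<gamma> p :: complex \<Rightarrow>\<^sub>0 complex poly"
  have \<gamma>: "\<alpha> + \<beta> \<in> \<Delta>" using \<Delta> \<alpha> \<beta> by (simp add: additive_subgrp_def)
  have carrier: "?S \<gamma> p \<in> lca_carrier (CL \<Delta> b \<phi>)" if "\<gamma> \<in> \<Delta>" for \<gamma> p
    using that by (simp add: CL_def)
  have conf: "conformal_linear (M \<gamma>)" if "\<gamma> \<in> \<Delta>" for \<gamma>
    using f carrier[OF that] by (auto simp: lca_hom_def M_def gc_def)
  have f_add: "f (x + y) = f x + f y"
    if "x \<in> lca_carrier (CL \<Delta> b \<phi>)" "y \<in> lca_carrier (CL \<Delta> b \<phi>)" for x y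
    using f that by (simp add: lca_hom_def)
  have f_scale: "f (CL_scale p x) = gc_scale p (f x)" if "x \<in> lca_carrier (CL \<Delta> b \<phi>)" for p x
    using f that by (simp add: lca_hom_def CL_def gc_def)
  define F where "F p = f (?S (\<alpha> + \<beta>) p)" for p
  have F_add: "F (p + q) = F p + F q" for p q
    by (simp add: F_def Poly_Mapping.single_add f_add carrier \<gamma>)
  have F_scale: "F (p * q) = gc_scale p (F q)" for p q
  proof -
    have "?S (\<alpha> + \<beta>) (p * q) = CL_scale p (?S (\<alpha> + \<beta>) q)"
      by (rule poly_mapping_eqI) (simp add: Poly_Mapping.lookup_single when_def)
    then show ?thesis by (simp add: F_def f_scale carrier \<gamma>)
  qed
  have F_0: "F 0 = 0" using F_add[of 0 0] by simp
  interpret poly_mod: cmodule "(*) :: complex poly \<Rightarrow> complex poly \<Rightarrow> complex poly"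
    by unfold_locales (simp_all add: algebra_simps)
  have pev_poly: "pev (*) s A = poly A s" for A :: "complex poly poly" and s
    by (induction A) simp_all
  have "map_poly f (CL_bracket b \<phi> (?S \<alpha> 1) (?S \<beta> 1)) = map_poly F (CL_coeff b \<phi> \<alpha> \<beta>)"
    unfolding CL_bracket_generators
    using F_0 by (intro poly_eqI) (simp add: coeff_map_poly F_def)
  moreover have "map_poly f (CL_bracket b \<phi> (?S \<alpha> 1) (?S \<beta> 1)) = gc_bracket (M \<alpha>) (M \<beta>)"
    using f \<alpha> \<beta> by (simp add: lca_hom_def CL_def gc_def M_def)
  ultimately have "pev gc_scale [:z:] (gc_bracket (M \<alpha>) (M \<beta>))
      = pev gc_scale [:z:] (map_poly F (CL_coeff b \<phi> \<alpha> \<beta>))"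
    by simp
  also have "\<dots> = F (poly (CL_coeff b \<phi> \<alpha> \<beta>) [:z:])"
    by (subst poly_mod.pev_map_add[of F "[:z:]" gc_scale "[:z:]", symmetric])
      (simp_all add: F_add F_scale gc.cmodule_axioms pev_poly)
  also have "\<dots> = gc_scale (poly (CL_coeff b \<phi> \<alpha> \<beta>) [:z:]) (M (\<alpha> + \<beta>))"
    using F_scale[of "poly (CL_coeff b \<phi> \<alpha> \<beta>) [:z:]" 1] by (simp add: F_def M_def)
  finally have "val (pev gc_scale [:z:] (gc_bracket (M \<alpha>) (M \<beta>))) (z + u) v
      = [:poly (poly (CL_coeff b \<phi> \<alpha> \<beta>) [:z:]) (- (z + u)):] *s val (M (\<alpha> + \<beta>)) (z + u) v"
    by (simp only: val_gc_scale)
  also have "poly (poly (CL_coeff b \<phi> \<alpha> \<beta>) [:z:]) (- (z + u)) = CL_num b \<phi> \<alpha> \<beta> z (- (z + u))"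
    by (simp add: CL_coeff_def CL_num_def algebra_simps)
  finally show ?thesis
    by (simp add: val_pev_gc_bracket conf \<alpha> \<beta> comm_at_def)
qed

theorem mainTheorem4:
  fixes \<Delta> :: "complex set" and b :: complex and \<phi> :: "complex \<Rightarrow> complex"
  assumes "additive_subgrp \<Delta>" and "infinite \<Delta>"
    and "2 * b \<notin> \<Delta>"
    and "\<forall>\<alpha>\<in>\<Delta>. \<forall>\<beta>\<in>\<Delta>. \<phi> (\<alpha> + \<beta>) = \<phi> \<alpha> + \<phi> \<beta>"
  shows "\<not> lca_embeds (CL \<Delta> b \<phi>) (gc :: (('n::finite) cmap) lca)"
proof
  assume "lca_embeds (CL \<Delta> b \<phi>) (gc :: ('n cmap) lca)"
  then obtain f :: "_ \<Rightarrow> 'n cmap" where f: "lca_hom (CL \<Delta> b \<phi>) gc f"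
    and inj: "inj_on f (lca_carrier (CL \<Delta> b \<phi>))"
    by (auto simp: lca_embeds_def)
  define M where "M = (\<lambda>\<alpha>. f (Poly_Mapping.single \<alpha> 1))"
  have b: "b \<notin> \<Delta>"
    using assms(1,3) by (metis additive_subgrp_def mult_2)
  have carrier: "Poly_Mapping.single \<alpha> p \<in> lca_carrier (CL \<Delta> b \<phi>)" if "\<alpha> \<in> \<Delta>" for \<alpha> p
    using that by (simp add: CL_def)
  interpret CL_action \<Delta> b \<phi> M
  proof
    show "conformal_linear (M \<alpha>)" if "\<alpha> \<in> \<Delta>" for \<alpha>
      using f carrier[OF that] by (auto simp: lca_hom_def M_def gc_def)
    show "val (M \<alpha>) z (val (M \<beta>) u v) - val (M \<beta>) u (val (M \<alpha>) z v)
        = [:CL_num b \<phi> \<alpha> \<beta> z (- (z + u)):] *s val (M (\<alpha> + \<beta>)) (z + u) v"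
      if "\<alpha> \<in> \<Delta>" "\<beta> \<in> \<Delta>" for \<alpha> \<beta> z u v
      unfolding M_def by (rule CL_hom_commutator[OF f assms(1) that])
  qed (use assms b in auto)
  have "M \<alpha> \<noteq> 0" if "\<alpha> \<in> \<Delta>" for \<alpha>
  proof
    assume "M \<alpha> = 0"
    have zero: "0 \<in> lca_carrier (CL \<Delta> b \<phi>)" by (simp add: CL_def)
    then have "f (0 + 0) = f 0 + f 0" using f unfolding lca_hom_def by blast
    then have "f (Poly_Mapping.single \<alpha> 1) = f 0" using \<open>M \<alpha> = 0\<close> by (simp add: M_def)
    then have "Poly_Mapping.single \<alpha> (1 :: complex poly) = 0"
      by (rule inj_onD[OF inj]) (use carrier[OF that] zero in auto)
    then show False by (metis lookup_single_eq lookup_zero one_neq_zero)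
  qed
  then obtain F N where "finite F"
    "\<And>\<beta>. \<beta> \<in> \<Delta> \<Longrightarrow> \<exists>c\<in>F. \<exists>k::int. k \<ge> - N \<and> \<beta> = c + b * of_int k"
    using weight_constraint add_mem by metis
  then have "finite \<Delta>" by (rule finite_additive_subgrp[OF assms(1) _ b_nonzero])
  with assms(2) show False by contradiction
qed

end
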